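(* The Fraïssé limit $(\mathbf{F},\preceq_\mathbf{F})$ of the class of finite ordered echeloned spaces has the Ramsey property; equivalently, the class of finite ordered echeloned spaces is a Ramsey class.
   Context: An echeloned space is a pair $(X,\leq_\mathbf{X})$ where $X$ is a non-empty set and $\leq_\mathbf{X}$ is a total preorder on $X^2$ such that for all $x,y,z$: $(x,x)\leq_\mathbf{X}(y,z)$; $(y,z)\leq_\mathbf{X}(x,x)$ implies $y=z$; $(x,y)\leq_\mathbf{X}(y,x)$. An ordered echeloned space additionally carries a linear order $\preceq$ on $X$; it is a relational structure with a $4$-ary relation ($(x_1,y_1)\leq(x_2,y_2)$) and the binary relation $\preceq$, and embeddings/substructures are understood for such relational structures. For structures $\mathbf{A},\mathbf{B}$, $\binom{\mathbf{B}}{\mathbf{A}}$ denotes the set of substructures of $\mathbf{B}$ isomorphic to $\mathbf{A}$. A class $\mathcal{C}$ is a Ramsey class if for all $\mathbf{A},\mathbf{B}\in\mathcal{C}$ and $k\in\mathbb{N}^+$ there is $\mathbf{C}\in\mathcal{C}$ such that for every partition of $\binom{\mathbf{C}}{\mathbf{A}}$ into $k$ classes there is $\tilde{\mathbf{B}}\in\binom{\mathbf{C}}{\mathbf{B}}$ with $\binom{\tilde{\mathbf{B}}}{\mathbf{A}}$ contained in a single class. A countable structure has the Ramsey property if the class of its finite substructures (its age) is a Ramsey class. *)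

theory Defs
  imports
    "HOL-Library.Countable_Set"
    "HOL-Library.Disjoint_Sets"
    "HOL-Library.Infinite_Typeclass"
begin

(* Relational structures with one 4-ary and one binary relation.  The 4-ary relation
   (x1,y1) <= (x2,y2) is kept as a binary relation on pairs. *)

record 'a ord_ech_struct =
  points :: "'a set"
  ech :: "(('a \<times> 'a) \<times> ('a \<times> 'a)) set"
  ord :: "('a \<times> 'a) set"

definition wf_struct :: "'a ord_ech_struct \<Rightarrow> bool" where
  "wf_struct A \<longleftrightarrow>
     points A \<noteq> {} \<and>
     ech A \<subseteq> (points A \<times> points A) \<times> (points A \<times> points A) \<and>
     ord A \<subseteq> points A \<times> points A"

definition induced :: "'a ord_ech_struct \<Rightarrow> 'a set \<Rightarrow> 'a ord_ech_struct" where
  "induced B S =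
     \<lparr>points = S,
      ech = ech B \<inter> (S \<times> S) \<times> (S \<times> S),
      ord = ord B \<inter> S \<times> S\<rparr>"

(* Substructures are induced and, as all structures here, non-empty. *)

definition substructures :: "'a ord_ech_struct \<Rightarrow> 'a ord_ech_struct set" where
  "substructures B = {induced B S |S. S \<subseteq> points B \<and> S \<noteq> {}}"

definition is_iso :: "('a \<Rightarrow> 'b) \<Rightarrow> 'a ord_ech_struct \<Rightarrow> 'b ord_ech_struct \<Rightarrow> bool" where
  "is_iso f A B \<longleftrightarrow>
     bij_betw f (points A) (points B) \<and>
     (\<forall>x1\<in>points A. \<forall>y1\<in>points A. \<forall>x2\<in>points A. \<forall>y2\<in>points A.
        ((x1, y1), (x2, y2)) \<in> ech A \<longleftrightarrow> ((f x1, f y1), (f x2, f y2)) \<in> ech B) \<and>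
     (\<forall>x\<in>points A. \<forall>y\<in>points A. (x, y) \<in> ord A \<longleftrightarrow> (f x, f y) \<in> ord B)"

definition isomorphic :: "'a ord_ech_struct \<Rightarrow> 'b ord_ech_struct \<Rightarrow> bool" where
  "isomorphic A B \<longleftrightarrow> (\<exists>f. is_iso f A B)"

definition copies :: "'a ord_ech_struct \<Rightarrow> 'b ord_ech_struct \<Rightarrow> 'a ord_ech_struct set" where
  "copies B A = {A' \<in> substructures B. isomorphic A' A}"

definition echeloned_space :: "'a set \<Rightarrow> (('a \<times> 'a) \<times> ('a \<times> 'a)) set \<Rightarrow> bool" where
  "echeloned_space X r \<longleftrightarrow>
     X \<noteq> {} \<and>
     preorder_on (X \<times> X) r \<and> total_on (X \<times> X) r \<and>
     (\<forall>x\<in>X. \<forall>y\<in>X. \<forall>z\<in>X. ((x, x), (y, z)) \<in> r) \<and>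
     (\<forall>x\<in>X. \<forall>y\<in>X. \<forall>z\<in>X. ((y, z), (x, x)) \<in> r \<longrightarrow> y = z) \<and>
     (\<forall>x\<in>X. \<forall>y\<in>X. ((x, y), (y, x)) \<in> r)"

definition ordered_echeloned_space :: "'a ord_ech_struct \<Rightarrow> bool" where
  "ordered_echeloned_space A \<longleftrightarrow>
     echeloned_space (points A) (ech A) \<and> linear_order_on (points A) (ord A)"

(* The class of finite ordered echeloned spaces, realised as the set of those whose points
   lie in the type 'a.  If 'a is infinite, every finite structure has an isomorphic copy
   over 'a, so this set represents all isomorphism types. *)

definition finite_ordered_echeloned_spaces :: "'a ord_ech_struct set" where
  "finite_ordered_echeloned_spaces = {A. ordered_echeloned_space A \<and> finite (points A)}"

definition age :: "'a ord_ech_struct \<Rightarrow> 'a ord_ech_struct set" where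
  "age F = {A \<in> substructures F. finite (points A)}"

(* Classes of a partition into k classes may be empty: otherwise a structure C with fewer
   than k copies of A would satisfy the condition vacuously. *)

definition ramsey_class :: "'a ord_ech_struct set \<Rightarrow> bool" where
  "ramsey_class K \<longleftrightarrow>
     (\<forall>A\<in>K. \<forall>B\<in>K. \<forall>k::nat. k \<ge> 1 \<longrightarrow>
        (\<exists>C\<in>K. \<forall>P :: nat \<Rightarrow> 'a ord_ech_struct set.
           disjoint_family_on P {..<k} \<and> (\<Union>i<k. P i) = copies C A \<longrightarrow>
           (\<exists>B'\<in>copies C B. \<exists>i<k. copies B' A \<subseteq> P i)))"

definition ramsey_property :: "'a ord_ech_struct \<Rightarrow> bool" where
  "ramsey_property F \<longleftrightarrow> ramsey_class (age F)"

definition homogeneous :: "'a ord_ech_struct \<Rightarrow> bool" where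
  "homogeneous F \<longleftrightarrow>
     (\<forall>A\<in>age F. \<forall>B\<in>age F. \<forall>f. is_iso f A B \<longrightarrow>
        (\<exists>g. is_iso g F F \<and> (\<forall>x\<in>points A. g x = f x)))"

(* Up to isomorphism, the age of F is the class K. *)

definition fraisse_limit :: "'a ord_ech_struct set \<Rightarrow> 'f ord_ech_struct \<Rightarrow> bool" where
  "fraisse_limit K F \<longleftrightarrow>
     wf_struct F \<and> countable (points F) \<and> homogeneous F \<and>
     (\<forall>A\<in>age F. \<exists>B\<in>K. isomorphic A B) \<and>
     (\<forall>B\<in>K. \<exists>A\<in>age F. isomorphic A B)"

end

theory Submission
  imports Defs "HOL-Library.Ramsey" "HOL-Library.Nat_Bijection"
begin

text \<open>An echelon is the order of the values of a distance with labels \<open>0 < 1 < 2 < \<dots>\<close>, so a copy of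
  \<open>A\<close> in a labelled complete graph is a copy of \<open>A\<close> as an edge-labelled ordered graph for some choice
  \<open>\<phi>\<close> of the label set.  For a fixed \<open>\<phi>\<close>, the Ramsey property of ordered edge-labelled complete graphs
  follows from the partite construction of Nesetril and Rodl: points are distributed over
  parts \<open>{..<p}\<close>, and for every pair \<open>(e, \<phi>)\<close> of a set of parts and a set of labels the Hales--Jewett
  theorem makes the copies of \<open>A\<close> over \<open>e\<close> with labels \<open>\<phi>\<close> monochromatic.  Since labels may be
  filled in arbitrarily, all systems can be taken to be complete, and homomorphisms suffice in place
  of embeddings.  Starting from a system with a copy of \<open>B\<close> over each pair \<open>(E, \<psi>)\<close> of the appropriate
  sizes, the colour of a copy of \<open>A\<close> ends up depending on \<open>(e, \<phi>)\<close> only, and Ramsey's theorem for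
  sets of parts and sets of labels gives a pair \<open>(E, \<psi>)\<close> on which it is constant.\<close>

section \<open>The Hales--Jewett theorem\<close>

definition words :: "'a set \<Rightarrow> nat \<Rightarrow> 'a list set" where
  "words A N = {w. set w \<subseteq> A \<and> length w = N}"

text \<open>In a combinatorial line, \<^const>\<open>None\<close> marks the moving coordinates.\<close>

definition lines :: "'a set \<Rightarrow> nat \<Rightarrow> 'a option list set" where
  "lines A N = {L. set L \<subseteq> insert None (Some ` A) \<and> length L = N \<and> None \<in> set L}"

definition line_point :: "'a option list \<Rightarrow> 'a \<Rightarrow> 'a list" where
  "line_point L a = map (case_option a id) L"

definition mono_line :: "'a set \<Rightarrow> nat \<Rightarrow> ('a list \<Rightarrow> 'c) \<Rightarrow> bool" where
  "mono_line A N \<chi> \<longleftrightarrow> (\<exists>L\<in>lines A N. \<exists>d. \<forall>a\<in>A. \<chi> (line_point L a) = d)"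

lemma finite_words: "finite A \<Longrightarrow> finite (words A N)"
  by (simp add: words_def finite_lists_length_eq)

lemma finite_lines: "finite A \<Longrightarrow> finite (lines A N)"
  by (rule finite_subset[OF _ finite_lists_length_eq[of "insert None (Some ` A)" N]])
    (auto simp: lines_def)

lemma line_point_append [simp]: "line_point (L @ M) a = line_point L a @ line_point M a"
  by (simp add: line_point_def)

lemma line_point_Some [simp]: "line_point (map Some w) a = w"
  by (simp add: line_point_def comp_def)

lemma line_point_in_words: "L \<in> lines A N \<Longrightarrow> a \<in> A \<Longrightarrow> line_point L a \<in> words A N"
  by (fastforce simp: lines_def words_def line_point_def split: option.splits)

lemma lines_mono: "A \<subseteq> B \<Longrightarrow> lines A N \<subseteq> lines B N"
  by (auto simp: lines_def)

lemma append_in_lines: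
  "\<lbrakk>L \<in> lines A N; M \<in> lines A N'\<rbrakk> \<Longrightarrow> L @ M \<in> lines A (N + N')"
  "\<lbrakk>L \<in> lines A N; w \<in> words A N'\<rbrakk> \<Longrightarrow> L @ map Some w \<in> lines A (N + N')"
  "\<lbrakk>w \<in> words A N; L \<in> lines A N'\<rbrakk> \<Longrightarrow> map Some w @ L \<in> lines A (N + N')"
  by (auto simp: lines_def words_def)

text \<open>When \<open>r = card C\<close>, the common point \<open>f\<close> of the \<open>r\<close> lines has the colour of one of them, and
  that line is then monochromatic on \<open>insert x A\<close>.\<close>

lemma colour_focusing:
  fixes C :: "nat set"
  assumes HJ: "\<And>C :: nat set. finite C \<Longrightarrow> \<exists>N. \<forall>\<chi>. range \<chi> \<subseteq> C \<longrightarrow> mono_line A N \<chi>"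
    and A: "finite A" "A \<noteq> {}" and C: "finite C"
  shows "\<exists>N. \<forall>\<chi>. range \<chi> \<subseteq> C \<longrightarrow> mono_line (insert x A) N \<chi> \<or>
    (\<exists>f\<in>words (insert x A) N. \<exists>D\<subseteq>C. card D = r \<and>
      (\<forall>d\<in>D. \<exists>L\<in>lines (insert x A) N. line_point L x = f \<and> (\<forall>a\<in>A. \<chi> (line_point L a) = d)))"
proof (induction r)
  case 0
  show ?case
    by (rule exI[of _ 0]) (auto simp: words_def intro!: exI[of _ "{}"])
next
  case (Suc r)
  let ?B = "insert x A"
  obtain N where N: "mono_line ?B N \<chi> \<or>
    (\<exists>f\<in>words ?B N. \<exists>D\<subseteq>C. card D = r \<and>
      (\<forall>d\<in>D. \<exists>L\<in>lines ?B N. line_point L x = f \<and> (\<forall>a\<in>A. \<chi> (line_point L a) = d)))"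
    if "range \<chi> \<subseteq> C" for \<chi>
    using Suc.IH by blast
  obtain us where us: "set us = words ?B N"
    using finite_words[of ?B N] finite_list A(1) by blast
  \<comment> \<open>A word \<open>w\<close> over \<open>A\<close> will be coloured by the list of
    the colours of all its extensions \<open>w @ u\<close>; \<open>list_encode\<close> turns such a
    list into one of finitely many numbers.\<close>
  have "finite (list_encode ` words C (length us))"
    using C by (simp add: finite_words)
  from HJ[OF this] obtain M
    where M: "range \<chi> \<subseteq> list_encode ` words C (length us) \<Longrightarrow> mono_line A M \<chi>" for \<chi>
    by blast
  show ?case
  proof (intro exI[of _ "M + N"] allI impI)
    fix \<chi> :: "'a list \<Rightarrow> nat"
    assume \<chi>: "range \<chi> \<subseteq> C"
    have "mono_line A M (\<lambda>w. list_encode (map (\<lambda>u. \<chi> (w @ u)) us))"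
      by (rule M) (use \<chi> in \<open>auto simp: words_def image_subset_iff intro!: imageI\<close>)
    then obtain L0 d0 where L0: "L0 \<in> lines A M"
      and d0: "\<And>a. a \<in> A \<Longrightarrow> list_encode (map (\<lambda>u. \<chi> (line_point L0 a @ u)) us) = d0"
      by (auto simp: mono_line_def)
    obtain a0 where a0: "a0 \<in> A"
      using A by blast
    \<comment> \<open>\<open>L0\<close> is monochromatic for these lists, so moving it within
      \<open>A\<close> changes the colour of no extension. Nothing is known yet at the letter
      \<open>x\<close>.\<close>
    have const: "\<chi> (line_point L0 a @ u) = \<chi> (line_point L0 a0 @ u)"
      if "a \<in> A" "u \<in> words ?B N" for a u
    proof -
      have "map (\<lambda>u. \<chi> (line_point L0 a @ u)) us = map (\<lambda>u. \<chi> (line_point L0 a0 @ u)) us"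
        using d0[OF that(1)] d0[OF a0] by (metis list_encode_eq)
      then show ?thesis
        using that us by (auto simp: map_eq_conv)
    qed
    have L0': "L0 \<in> lines ?B M"
      using L0 lines_mono[of A ?B M] by blast
    have w0: "line_point L0 a0 \<in> words ?B M"
      using L0' a0 by (simp add: line_point_in_words)
    let ?\<chi> = "\<lambda>u. \<chi> (line_point L0 a0 @ u)"
    have "range ?\<chi> \<subseteq> C"
      using \<chi> by auto
    from N[OF this] consider
      (mono) "mono_line ?B N ?\<chi>" |
      (focus) f D where "f \<in> words ?B N" "D \<subseteq> C" "card D = r"
        "\<And>d. d \<in> D \<Longrightarrow> \<exists>L\<in>lines ?B N. line_point L x = f \<and> (\<forall>a\<in>A. ?\<chi> (line_point L a) = d)"
      by blast
    then show "mono_line ?B (M + N) \<chi> \<or>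
      (\<exists>f\<in>words ?B (M + N). \<exists>D\<subseteq>C. card D = Suc r \<and>
        (\<forall>d\<in>D. \<exists>L\<in>lines ?B (M + N). line_point L x = f \<and> (\<forall>a\<in>A. \<chi> (line_point L a) = d)))"
    proof cases
      case mono
      then obtain L d where L: "L \<in> lines ?B N" "\<And>a. a \<in> ?B \<Longrightarrow> ?\<chi> (line_point L a) = d"
        by (auto simp: mono_line_def)
      have "map Some (line_point L0 a0) @ L \<in> lines ?B (M + N)"
        using w0 L(1) by (rule append_in_lines)
      moreover have "\<forall>a\<in>?B. \<chi> (line_point (map Some (line_point L0 a0) @ L) a) = d"
        using L(2) by simp
      ultimately show ?thesis
        unfolding mono_line_def by blast
    next
      case focus
      show ?thesis
      proof (cases "?\<chi> f \<in> D")
        case True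
        then obtain L where L: "L \<in> lines ?B N" "line_point L x = f"
          "\<And>a. a \<in> A \<Longrightarrow> ?\<chi> (line_point L a) = ?\<chi> f"
          using focus(4) by meson
        have "map Some (line_point L0 a0) @ L \<in> lines ?B (M + N)"
          using w0 L(1) by (rule append_in_lines)
        moreover have "\<forall>a\<in>?B. \<chi> (line_point (map Some (line_point L0 a0) @ L) a) = ?\<chi> f"
          using L(2,3) by auto
        ultimately show ?thesis
          unfolding mono_line_def by blast
      next
        \<comment> \<open>The colour of \<open>f\<close> is new. Each old line is prolonged by
          letting \<open>L0\<close> move along with it, and \<open>L0\<close> followed by the fixed
          word \<open>f\<close> is the additional line. All of them focus at
          \<open>line_point L0 x @ f\<close>.\<close>
        case False
        have "finite D"
          using focus(2) C finite_subset by blast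
        then have "card (insert (?\<chi> f) D) = Suc r"
          using False focus(3) by simp
        moreover have "insert (?\<chi> f) D \<subseteq> C"
          using focus(2) \<chi> by auto
        moreover have "line_point L0 x @ f \<in> words ?B (M + N)"
          using line_point_in_words[OF L0', of x] focus(1) by (auto simp: words_def)
        moreover have "\<exists>L\<in>lines ?B (M + N). line_point L x = line_point L0 x @ f \<and>
            (\<forall>a\<in>A. \<chi> (line_point L a) = d)" if "d \<in> insert (?\<chi> f) D" for d
        proof (cases "d \<in> D")
          case True
          then obtain L where L: "L \<in> lines ?B N" "line_point L x = f"
            "\<And>a. a \<in> A \<Longrightarrow> ?\<chi> (line_point L a) = d"
            using focus(4) by meson
          have "\<chi> (line_point (L0 @ L) a) = d" if "a \<in> A" for a
            using L(3)[OF that] const[OF that] line_point_in_words[OF L(1), of a] that by simp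
          then show ?thesis
            using append_in_lines(1)[OF L0' L(1)] L(2) by (intro bexI[of _ "L0 @ L"]) auto
        next
          case False
          then have "\<chi> (line_point (L0 @ map Some f) a) = d" if "a \<in> A" for a
            using const[OF that focus(1)] \<open>d \<in> insert (?\<chi> f) D\<close> by simp
          then show ?thesis
            using append_in_lines(2)[OF L0' focus(1)]
            by (intro bexI[of _ "L0 @ map Some f"]) auto
        qed
        ultimately show ?thesis
          by blast
      qed
    qed
  qed
qed

text \<open>Induction on the alphabet by colour focusing. The set of colours is kept arbitrary
  because the step to \<open>insert x A\<close> uses the hypothesis for \<open>A\<close> with lists
  of colours as colours.\<close>

theorem hales_jewett:
  fixes C :: "nat set"
  assumes "finite A" "finite C"
  shows "\<exists>N. \<forall>\<chi>. range \<chi> \<subseteq> C \<longrightarrow> mono_line A N \<chi>"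
  using assms
proof (induction A arbitrary: C rule: finite_induct)
  case empty
  have "[None] \<in> lines {} 1"
    by (simp add: lines_def)
  then show ?case
    unfolding mono_line_def by blast
next
  case (insert x A)
  show ?case
  proof (cases "A = {}")
    case True
    have "[None] \<in> lines {x} 1"
      by (simp add: lines_def)
    then show ?thesis
      using True unfolding mono_line_def by blast
  next
    case False
    from colour_focusing[OF insert.IH insert.hyps(1) False \<open>finite C\<close>, of x "card C"]
    obtain N where N: "mono_line (insert x A) N \<chi> \<or>
      (\<exists>f\<in>words (insert x A) N. \<exists>D\<subseteq>C. card D = card C \<and>
        (\<forall>d\<in>D. \<exists>L\<in>lines (insert x A) N. line_point L x = f \<and> (\<forall>a\<in>A. \<chi> (line_point L a) = d)))"
      if "range \<chi> \<subseteq> C" for \<chi>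
      by blast
    have "mono_line (insert x A) N \<chi>" if \<chi>: "range \<chi> \<subseteq> C" for \<chi>
      using N[OF \<chi>]
    proof
      assume "\<exists>f\<in>words (insert x A) N. \<exists>D\<subseteq>C. card D = card C \<and>
        (\<forall>d\<in>D. \<exists>L\<in>lines (insert x A) N. line_point L x = f \<and> (\<forall>a\<in>A. \<chi> (line_point L a) = d))"
      then obtain f D where "D \<subseteq> C" "card D = card C" and
        D: "\<And>d. d \<in> D \<Longrightarrow>
          \<exists>L\<in>lines (insert x A) N. line_point L x = f \<and> (\<forall>a\<in>A. \<chi> (line_point L a) = d)"
        by blast
      then have "D = C"
        using card_subset_eq[OF \<open>finite C\<close>] by blast
      then have "\<chi> f \<in> D"
        using \<chi> by blast
      from D[OF this] show ?thesis
        unfolding mono_line_def by (metis insert_iff)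
    qed
    then show ?thesis
      by blast
  qed
qed

section \<open>Partite construction\<close>

text \<open>A partite system \<open>(V, \<pi>, c)\<close> has points \<open>V\<close>, the part \<open>\<pi> x\<close> of each point \<open>x\<close>, and a label
  \<open>c x y\<close> for all points \<open>x\<close>, \<open>y\<close> with \<open>\<pi> x < \<pi> y\<close>.  The values of \<open>c\<close> on other pairs are junk.\<close>

definition partite_hom ::
  "'u set \<Rightarrow> ('u \<Rightarrow> nat) \<Rightarrow> ('u \<Rightarrow> 'u \<Rightarrow> nat) \<Rightarrow> 'v set \<Rightarrow> ('v \<Rightarrow> nat) \<Rightarrow> ('v \<Rightarrow> 'v \<Rightarrow> nat) \<Rightarrow>
    ('u \<Rightarrow> 'v) \<Rightarrow> bool" where
  "partite_hom V \<pi> c V' \<pi>' c' h \<longleftrightarrow> h ` V \<subseteq> V' \<and> (\<forall>x\<in>V. \<pi>' (h x) = \<pi> x) \<and>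
     (\<forall>x\<in>V. \<forall>y\<in>V. \<pi> x < \<pi> y \<longrightarrow> c' (h x) (h y) = c x y)"

text \<open>Candidates for copies of a structure with edge labels \<open>t\<close> on the ordered
  set \<open>e\<close>: one point in each part of \<open>e\<close>.\<close>

definition transversals ::
  "'v set \<Rightarrow> ('v \<Rightarrow> nat) \<Rightarrow> ('v \<Rightarrow> 'v \<Rightarrow> nat) \<Rightarrow> nat set \<Rightarrow> (nat \<Rightarrow> nat \<Rightarrow> nat) \<Rightarrow> 'v set set" where
  "transversals V \<pi> c e t = {S. S \<subseteq> V \<and> bij_betw \<pi> S e \<and>
     (\<forall>x\<in>S. \<forall>y\<in>S. \<pi> x < \<pi> y \<longrightarrow> c x y = t (\<pi> x) (\<pi> y))}"

lemma partite_hom_id: "partite_hom V \<pi> c V \<pi> c id"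
  by (simp add: partite_hom_def)

lemma partite_hom_comp:
  assumes "partite_hom V \<pi> c V' \<pi>' c' h" "partite_hom V' \<pi>' c' V'' \<pi>'' c'' h'"
  shows "partite_hom V \<pi> c V'' \<pi>'' c'' (h' \<circ> h)"
  using assms unfolding partite_hom_def by (auto simp: image_subset_iff)

text \<open>Distinct points of \<open>S\<close> lie in distinct parts and \<open>h\<close> preserves
  parts, so \<open>h\<close> is injective on \<open>S\<close>.\<close>

lemma partite_hom_transversal:
  assumes h: "partite_hom V \<pi> c V' \<pi>' c' h" and S: "S \<in> transversals V \<pi> c e t"
  shows "h ` S \<in> transversals V' \<pi>' c' e t"
proof -
  have sub: "S \<subseteq> V"
    using S by (simp add: transversals_def)
  then have \<pi>: "\<pi>' (h x) = \<pi> x" if "x \<in> S" for x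
    using h that by (auto simp: partite_hom_def)
  have "bij_betw (\<pi>' \<circ> h) S e"
    using S \<pi> by (subst bij_betw_cong[of S _ \<pi>]) (auto simp: transversals_def)
  then have "bij_betw \<pi>' (h ` S) e"
    by (auto simp: bij_betw_def inj_on_imageI2 image_comp inj_on_imageI)
  moreover have "h ` S \<subseteq> V'"
    using h sub by (auto simp: partite_hom_def)
  moreover have "c' (h x) (h y) = t (\<pi>' (h x)) (\<pi>' (h y))"
    if "x \<in> S" "y \<in> S" "\<pi>' (h x) < \<pi>' (h y)" for x y
    using h S sub that \<pi> by (auto simp: partite_hom_def transversals_def subset_iff)
  ultimately show ?thesis
    by (simp add: transversals_def)
qed

lemma infinite_type_embedding:
  assumes "finite V"
  obtains f :: "'u \<Rightarrow> 'a::infinite" where "inj_on f V"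
proof -
  obtain W :: "'a set" where "card W = card V" "finite W"
    using infinite_arbitrarily_large[OF infinite_UNIV, of "card V"] by metis
  then show thesis
    using finite_same_card_bij[OF assms] that by (metis bij_betw_def)
qed

text \<open>A power of a system lives on a different type. Renaming its finitely many points within
  an infinite type allows the construction to be iterated at one fixed type.\<close>

lemma partite_transfer:
  assumes "finite V"
  obtains V' \<pi>' c' and h :: "'u \<Rightarrow> 'a::infinite"
  where "finite V'" "partite_hom V \<pi> c V' \<pi>' c' h"
proof -
  obtain h :: "'u \<Rightarrow> 'a" where h: "inj_on h V"
    using infinite_type_embedding[OF assms] .
  let ?g = "inv_into V h"
  show thesis
    by (rule that[of "h ` V" "\<pi> \<circ> ?g" "\<lambda>x y. c (?g x) (?g y)" h])
      (use assms h in \<open>auto simp: partite_hom_def image_image\<close>)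
qed

locale partite_power =
  fixes V :: "'v set" and \<pi> :: "'v \<Rightarrow> nat" and c :: "'v \<Rightarrow> 'v \<Rightarrow> nat"
    and e :: "nat set" and t :: "nat \<Rightarrow> nat \<Rightarrow> nat" and N :: nat
  assumes finite_V: "finite V"
begin

text \<open>Over the parts in \<open>e\<close> the system is an \<open>N\<close>-th power, with one copy \<open>Inr ` ({L} \<times> _)\<close> of the
  remaining parts attached to it for each combinatorial line \<open>L\<close> in \<open>T ^ N\<close>.
  A label in the power is the one that differs from the label required by \<open>t\<close> if there is any.\<close>

abbreviation "T \<equiv> transversals V \<pi> c e t"

text \<open>A word is assigned to the part of its first entry. Words with entries in several parts
  are harmless: no homomorphism along a line meets them.\<close>

definition pow_points :: "('v list + 'v set option list \<times> 'v) set" where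
  "pow_points = Inl ` {w. w \<in> words V N \<and> \<pi> (hd w) \<in> e} \<union> Inr ` (lines T N \<times> {v \<in> V. \<pi> v \<notin> e})"

definition pow_part :: "'v list + 'v set option list \<times> 'v \<Rightarrow> nat" where
  "pow_part u = (case u of Inl w \<Rightarrow> \<pi> (hd w) | Inr (L, v) \<Rightarrow> \<pi> v)"

definition pow_list_label :: "'v list \<Rightarrow> 'v list \<Rightarrow> nat" where
  "pow_list_label w w' = (let t0 = t (\<pi> (hd w)) (\<pi> (hd w')) in
     if \<exists>n<N. c (w ! n) (w' ! n) \<noteq> t0
     then c (w ! (LEAST n. c (w ! n) (w' ! n) \<noteq> t0)) (w' ! (LEAST n. c (w ! n) (w' ! n) \<noteq> t0))
     else t0)"

definition moving :: "'x option list \<Rightarrow> nat" where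
  "moving L = (LEAST n. n < length L \<and> L ! n = None)"

text \<open>Between a word and a point attached to the line \<open>L\<close> the label is read off
  at the first moving coordinate of \<open>L\<close>, where a word on that line shows the original
  point.\<close>

definition pow_label :: "'v list + 'v set option list \<times> 'v \<Rightarrow> 'v list + 'v set option list \<times> 'v \<Rightarrow> nat" where
  "pow_label u u' = (case u of
     Inl w \<Rightarrow> (case u' of Inl w' \<Rightarrow> pow_list_label w w' | Inr (L, v) \<Rightarrow> c (w ! moving L) v)
   | Inr (L, v) \<Rightarrow> (case u' of Inl w' \<Rightarrow> c v (w' ! moving L) | Inr (L', v') \<Rightarrow> c v v'))"

definition repr :: "'v set \<Rightarrow> nat \<Rightarrow> 'v" where
  "repr S i = the_inv_into S \<pi> i"

text \<open>The alphabet consists of transversals: a fixed letter \<open>S\<close> contributes its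
  point in the part of \<open>x\<close>, a moving coordinate contributes \<open>x\<close>
  itself.\<close>

definition line_word :: "'v set option list \<Rightarrow> 'v \<Rightarrow> 'v list" where
  "line_word L x = map (case_option x (\<lambda>S. repr S (\<pi> x))) L"

definition line_hom :: "'v set option list \<Rightarrow> 'v \<Rightarrow> 'v list + 'v set option list \<times> 'v" where
  "line_hom L x = (if \<pi> x \<in> e then Inl (line_word L x) else Inr (L, x))"

section \<open>Homomorphisms into the power along combinatorial lines\<close>

lemma repr:
  assumes "S \<in> T" "i \<in> e"
  shows "repr S i \<in> S" "repr S i \<in> V" "\<pi> (repr S i) = i"
proof -
  have "bij_betw \<pi> S e" "S \<subseteq> V"
    using assms by (auto simp: transversals_def)
  then show "repr S i \<in> S" "\<pi> (repr S i) = i"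
    using assms(2) unfolding repr_def
    by (auto simp: bij_betw_def the_inv_into_into f_the_inv_into_f)
  then show "repr S i \<in> V"
    using \<open>S \<subseteq> V\<close> by auto
qed

lemma repr_part: "S \<in> T \<Longrightarrow> x \<in> S \<Longrightarrow> repr S (\<pi> x) = x"
  by (auto simp: repr_def transversals_def bij_betw_def the_inv_into_f_f)

lemma repr_label:
  assumes "S \<in> T" "i \<in> e" "j \<in> e" "i < j"
  shows "c (repr S i) (repr S j) = t i j"
  using assms repr[OF assms(1,2)] repr[OF assms(1,3)] by (auto simp: transversals_def)

lemma finite_pow_points: "finite pow_points"
proof -
  have "finite T"
    by (rule finite_subset[of _ "Pow V"]) (auto simp: transversals_def finite_V)
  then show ?thesis
    unfolding pow_points_def
    by (intro finite_UnI finite_imageI finite_SigmaI) (simp_all add: finite_V finite_words finite_lines)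
qed

lemma nth_moving:
  assumes "L \<in> lines T N"
  shows "moving L < N" "L ! moving L = None"
proof -
  have "\<exists>n. n < length L \<and> L ! n = None"
    using assms by (auto simp: lines_def in_set_conv_nth)
  from LeastI_ex[OF this] show "moving L < N" "L ! moving L = None"
    using assms by (auto simp: moving_def lines_def)
qed

lemma line_word_nth:
  assumes "L \<in> lines T N" "n < N"
  shows "line_word L x ! n = (case L ! n of None \<Rightarrow> x | Some S \<Rightarrow> repr S (\<pi> x))"
    and "L ! n = None \<or> (\<exists>S\<in>T. L ! n = Some S)"
proof -
  have n: "n < length L" "set L \<subseteq> insert None (Some ` T)"
    using assms by (auto simp: lines_def)
  then show "line_word L x ! n = (case L ! n of None \<Rightarrow> x | Some S \<Rightarrow> repr S (\<pi> x))"
    by (simp add: line_word_def)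
  have "L ! n \<in> set L"
    using n by simp
  then show "L ! n = None \<or> (\<exists>S\<in>T. L ! n = Some S)"
    using n(2) by auto
qed

lemma line_word:
  assumes L: "L \<in> lines T N" and x: "x \<in> V" "\<pi> x \<in> e"
  shows "line_word L x \<in> words V N" "\<pi> (hd (line_word L x)) = \<pi> x"
proof -
  have len: "length (line_word L x) = N"
    using L by (simp add: line_word_def lines_def)
  have nth: "line_word L x ! n \<in> V \<and> \<pi> (line_word L x ! n) = \<pi> x" if "n < N" for n
    using line_word_nth[OF L that] x repr by fastforce
  have "set (line_word L x) \<subseteq> V"
    using nth len by (auto simp: in_set_conv_nth)
  then show "line_word L x \<in> words V N"
    using len by (simp add: words_def)
  \<comment> \<open>A line has a moving coordinate, so its words are non-empty and \<open>hd\<close>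
    is their entry 0.\<close>
  have "0 < N"
    using nth_moving(1)[OF L] by simp
  then show "\<pi> (hd (line_word L x)) = \<pi> x"
    using nth[of 0] len hd_conv_nth[of "line_word L x"] by fastforce
qed

text \<open>Fixed coordinates show the label required by \<open>t\<close>, moving ones show
  \<open>c x y\<close>. Hence a deviation from \<open>t\<close> can only be \<open>c x y\<close>,
  and if there is none, \<open>c x y\<close> agrees with \<open>t\<close> because some coordinate
  moves.\<close>

lemma line_word_label:
  assumes L: "L \<in> lines T N" and x: "x \<in> V" "\<pi> x \<in> e" and y: "y \<in> V" "\<pi> y \<in> e"
    and less: "\<pi> x < \<pi> y"
  shows "pow_list_label (line_word L x) (line_word L y) = c x y"
proof -
  let ?w = "line_word L x" and ?w' = "line_word L y" and ?t = "t (\<pi> x) (\<pi> y)"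
  let ?n = "LEAST n. c (?w ! n) (?w' ! n) \<noteq> ?t"
  have nth: "c (?w ! n) (?w' ! n) = (case L ! n of None \<Rightarrow> c x y | Some S \<Rightarrow> ?t)" if "n < N" for n
    using line_word_nth[OF L that] repr_label x y less by fastforce
  have hd: "\<pi> (hd ?w) = \<pi> x" "\<pi> (hd ?w') = \<pi> y"
    using line_word L x y by blast+
  show ?thesis
  proof (cases "\<exists>n<N. c (?w ! n) (?w' ! n) \<noteq> ?t")
    case True
    then obtain n where n: "n < N" "c (?w ! n) (?w' ! n) \<noteq> ?t"
      by blast
    have "?n \<le> n" "c (?w ! ?n) (?w' ! ?n) \<noteq> ?t"
      using n(2) by (rule Least_le, rule LeastI)
    then have "c (?w ! ?n) (?w' ! ?n) = c x y"
      using nth[of ?n] n(1) by (auto split: option.splits)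
    then show ?thesis
      using True by (simp add: pow_list_label_def hd Let_def)
  next
    case False
    then have "c x y = ?t"
      using nth[of "moving L"] nth_moving[OF L] by auto
    then show ?thesis
      unfolding pow_list_label_def hd Let_def by (subst if_not_P[OF False]) simp
  qed
qed

lemma line_hom:
  assumes L: "L \<in> lines T N"
  shows "partite_hom V \<pi> c pow_points pow_part pow_label (line_hom L)"
  unfolding partite_hom_def
proof (intro conjI ballI impI)
  show "line_hom L ` V \<subseteq> pow_points"
    using line_word[OF L] L by (auto simp: line_hom_def pow_points_def)
next
  fix x assume x: "x \<in> V"
  show "pow_part (line_hom L x) = \<pi> x"
    using line_word[OF L x] by (auto simp: line_hom_def pow_part_def)
next
  fix x y assume "x \<in> V" "y \<in> V" "\<pi> x < \<pi> y"
  moreover have "line_word L z ! moving L = z" for z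
    using line_word_nth(1)[OF L, of "moving L"] nth_moving[OF L] by simp
  ultimately show "pow_label (line_hom L x) (line_hom L y) = c x y"
    using line_word_label[OF L] by (auto simp: line_hom_def pow_label_def)
qed

text \<open>The image of \<open>S\<close> depends only on the word \<open>line_point L S\<close>, so
  a colouring of sets of points induces a colouring of words over \<open>T\<close>.\<close>

lemma line_hom_image:
  assumes S: "S \<in> T"
  shows "line_hom L ` S = (\<lambda>i. Inl (map (\<lambda>S. repr S i) (line_point L S))) ` e"
proof -
  have e: "e = \<pi> ` S"
    using S by (simp add: transversals_def bij_betw_def)
  have "line_hom L x = Inl (map (\<lambda>S. repr S (\<pi> x)) (line_point L S))" if "x \<in> S" for x
  proof -
    have "\<pi> x \<in> e"
      using that e by blast
    then show ?thesis
      using repr_part[OF S that]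
      by (auto simp: line_hom_def line_word_def line_point_def split: option.splits)
  qed
  then show ?thesis
    by (auto simp: e)
qed

end

text \<open>The constant \<open>d\<close> may differ from pair to pair; making it the same for the
  relevant pairs is left to Ramsey's theorem.\<close>

definition partite_arrow ::
  "nat \<Rightarrow> (nat set \<times> (nat \<Rightarrow> nat \<Rightarrow> nat)) list \<Rightarrow> 'u set \<Rightarrow> ('u \<Rightarrow> nat) \<Rightarrow> ('u \<Rightarrow> 'u \<Rightarrow> nat) \<Rightarrow>
    'v set \<Rightarrow> ('v \<Rightarrow> nat) \<Rightarrow> ('v \<Rightarrow> 'v \<Rightarrow> nat) \<Rightarrow> bool" where
  "partite_arrow k ets V \<pi> c V' \<pi>' c' \<longleftrightarrow> (\<forall>\<chi>. range \<chi> \<subseteq> {..<k} \<longrightarrow>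
    (\<exists>h. partite_hom V \<pi> c V' \<pi>' c' h \<and>
      (\<forall>et\<in>set ets. \<exists>d. \<forall>S\<in>transversals V \<pi> c (fst et) (snd et). \<chi> (h ` S) = d)))"

lemma partite_arrow_Nil: "partite_arrow k [] V \<pi> c V \<pi> c"
  unfolding partite_arrow_def by (auto intro!: exI[of _ id] partite_hom_id)

text \<open>For a given colouring, \<open>h2\<close> settles the pair \<open>(e, t)\<close> on
  \<open>V1\<close>, and \<open>h1\<close> settles \<open>ets\<close> for the colouring pulled back
  along \<open>h2\<close>. Constancy for \<open>(e, t)\<close> survives since \<open>h1\<close> maps
  transversals to transversals.\<close>

lemma partite_arrow_Cons:
  fixes V1 :: "'v set" and V2 :: "'w set"
  assumes "partite_arrow k ets V \<pi> c V1 \<pi>1 c1" "partite_arrow k [(e, t)] V1 \<pi>1 c1 V2 \<pi>2 c2"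
  shows "partite_arrow k ((e, t) # ets) V \<pi> c V2 \<pi>2 c2"
  unfolding partite_arrow_def
proof (intro allI impI)
  fix \<chi> :: "'w set \<Rightarrow> nat"
  assume \<chi>: "range \<chi> \<subseteq> {..<k}"
  obtain h2 d2 where h2: "partite_hom V1 \<pi>1 c1 V2 \<pi>2 c2 h2"
    and d2: "\<forall>S\<in>transversals V1 \<pi>1 c1 e t. \<chi> (h2 ` S) = d2"
    using assms(2)[unfolded partite_arrow_def, rule_format, OF \<chi>] by auto
  have "range (\<lambda>S. \<chi> (h2 ` S)) \<subseteq> {..<k}"
    using \<chi> by blast
  from assms(1)[unfolded partite_arrow_def, rule_format, OF this]
  obtain h1 where h1: "partite_hom V \<pi> c V1 \<pi>1 c1 h1"
    and d1: "\<forall>et\<in>set ets. \<exists>d. \<forall>S\<in>transversals V \<pi> c (fst et) (snd et). \<chi> (h2 ` h1 ` S) = d"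
    by (elim exE conjE)
  have "\<exists>d. \<forall>S\<in>transversals V \<pi> c (fst et) (snd et). \<chi> ((h2 \<circ> h1) ` S) = d"
    if "et \<in> set ((e, t) # ets)" for et
  proof (cases "et = (e, t)")
    case True
    have "\<chi> (h2 ` h1 ` S) = d2" if "S \<in> transversals V \<pi> c e t" for S
      using d2 partite_hom_transversal[OF h1 that] by (rule bspec)
    then show ?thesis
      unfolding True fst_conv snd_conv image_comp[symmetric] by (intro exI ballI)
  next
    case False
    then have "et \<in> set ets"
      using that by simp
    with d1 show ?thesis
      unfolding image_comp[symmetric] by (rule bspec)
  qed
  then show "\<exists>h. partite_hom V \<pi> c V2 \<pi>2 c2 h \<and> (\<forall>et\<in>set ((e, t) # ets).
      \<exists>d. \<forall>S\<in>transversals V \<pi> c (fst et) (snd et). \<chi> (h ` S) = d)"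
    using partite_hom_comp[OF h1 h2] by (intro exI[of _ "h2 \<circ> h1"] conjI ballI)
qed

text \<open>The exponent of the power is the dimension that Hales--Jewett yields for the alphabet of
  transversals; the homomorphism along a monochromatic line is the one required.\<close>

lemma partite_ramsey_single:
  assumes V: "finite V"
  shows "\<exists>(V' :: 'a::infinite set) \<pi>' c'. finite V' \<and> partite_arrow k [(e, t)] V \<pi> c V' \<pi>' c'"
proof -
  let ?T = "transversals V \<pi> c e t"
  have "finite ?T"
    by (rule finite_subset[of _ "Pow V"]) (auto simp: transversals_def V)
  from hales_jewett[OF this, of "{..<k}"] obtain N
    where N: "\<forall>\<chi>. range \<chi> \<subseteq> {..<k} \<longrightarrow> mono_line ?T N \<chi>"
    by (meson finite_lessThan)
  interpret partite_power V \<pi> c e t N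
    by unfold_locales (rule V)
  obtain V' :: "'a set" and \<pi>' c' g where V': "finite V'"
    and g: "partite_hom pow_points pow_part pow_label V' \<pi>' c' g"
    using partite_transfer[OF finite_pow_points] .
  have "partite_arrow k [(e, t)] V \<pi> c V' \<pi>' c'"
    unfolding partite_arrow_def
  proof (intro allI impI)
    fix \<chi> :: "'a set \<Rightarrow> nat"
    assume \<chi>: "range \<chi> \<subseteq> {..<k}"
    \<comment> \<open>A word \<open>W\<close> of transversals yields one point of the power for each
      part in \<open>e\<close>; the colour of this set is taken as the colour of
      \<open>W\<close>.\<close>
    have "mono_line ?T N (\<lambda>W. \<chi> (g ` (\<lambda>i. Inl (map (\<lambda>S. repr S i) W)) ` e))"
      by (rule N[rule_format]) (use \<chi> in auto)
    then obtain L d where L: "L \<in> lines ?T N"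
      and d: "\<forall>S\<in>?T. \<chi> (g ` (\<lambda>i. Inl (map (\<lambda>S. repr S i) (line_point L S))) ` e) = d"
      unfolding mono_line_def by (elim bexE exE) (rule that)
    have "\<chi> ((g \<circ> line_hom L) ` S) = d" if "S \<in> ?T" for S
      unfolding image_comp[symmetric] line_hom_image[OF that] using d that by (rule bspec)
    then show "\<exists>h. partite_hom V \<pi> c V' \<pi>' c' h \<and>
        (\<forall>et\<in>set [(e, t)]. \<exists>d. \<forall>S\<in>transversals V \<pi> c (fst et) (snd et). \<chi> (h ` S) = d)"
      by (intro exI[of _ "g \<circ> line_hom L"] exI[of _ d] conjI ballI partite_hom_comp[OF line_hom[OF L] g])
        (simp_all del: image_comp comp_apply)
  qed
  with V' show ?thesis
    by (intro exI[of _ V'] exI[of _ \<pi>'] exI[of _ c'] conjI)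
qed

lemma partite_ramsey:
  fixes V :: "'a::infinite set"
  assumes V: "finite V"
  shows "\<exists>(V' :: 'a set) \<pi>' c'. finite V' \<and> partite_arrow k ets V \<pi> c V' \<pi>' c'"
proof (induction ets)
  case Nil
  show ?case
    by (intro exI[of _ V] exI[of _ \<pi>] exI[of _ c] conjI V partite_arrow_Nil)
next
  case (Cons et ets)
  obtain e t where et: "et = (e, t)"
    by fastforce
  from Cons.IH obtain V1 :: "'a set" and \<pi>1 c1
    where V1: "finite V1" and 1: "partite_arrow k ets V \<pi> c V1 \<pi>1 c1"
    by (elim exE conjE)
  from partite_ramsey_single[OF V1, of k e t \<pi>1 c1] obtain V2 :: "'a set" and \<pi>2 c2
    where V2: "finite V2" and 2: "partite_arrow k [(e, t)] V1 \<pi>1 c1 V2 \<pi>2 c2"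
    by (elim exE conjE)
  show ?case
    unfolding et
    by (intro exI[of _ V2] exI[of _ \<pi>2] exI[of _ c2] conjI V2 partite_arrow_Cons[OF 1 2])
qed

section \<open>Order isomorphisms of finite sets of numbers\<close>

definition rank :: "nat set \<Rightarrow> nat \<Rightarrow> nat" where
  "rank D x = card {y \<in> D. y < x}"

text \<open>For finite sets of the same size this is the order isomorphism from \<open>D\<close> to \<open>E\<close>.\<close>

definition relabel :: "nat set \<Rightarrow> nat set \<Rightarrow> nat \<Rightarrow> nat" where
  "relabel D E x = enumerate E (rank D x)"

lemma rank_less_card: "finite D \<Longrightarrow> x \<in> D \<Longrightarrow> rank D x < card D"
  unfolding rank_def by (rule psubset_card_mono) auto

lemma rank_strict_mono: "finite D \<Longrightarrow> x \<in> D \<Longrightarrow> x < y \<Longrightarrow> rank D x < rank D y"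
  unfolding rank_def by (rule psubset_card_mono) auto

lemma enumerate_rank:
  assumes "finite E" "x \<in> E"
  shows "enumerate E (rank E x) = x"
proof -
  obtain n where n: "n < card E" "x = enumerate E n"
    using finite_enumerate_Ex[OF assms] by metis
  have bij: "bij_betw (enumerate E) {..<card E} E"
    using assms(1) by (rule finite_bij_enumerate)
  have "{y \<in> E. y < x} = enumerate E ` {..<n}"
  proof (intro equalityI subsetI)
    fix y assume "y \<in> {y \<in> E. y < x}"
    then obtain m where "m < card E" "y = enumerate E m" "y < x"
      using finite_enumerate_Ex[OF assms(1), of y] by auto
    then show "y \<in> enumerate E ` {..<n}"
      using n assms(1) by auto
  next
    fix y assume "y \<in> enumerate E ` {..<n}"
    then show "y \<in> {y \<in> E. y < x}"
      using n assms(1) by (auto simp: finite_enumerate_in_set)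
  qed
  moreover have "inj_on (enumerate E) {..<n}"
    using bij n(1) by (auto simp: bij_betw_def intro: inj_on_subset)
  ultimately have "rank E x = n"
    by (simp add: rank_def card_image)
  then show ?thesis
    using n by simp
qed

context
  fixes D E :: "nat set"
  assumes fin: "finite D" "finite E" and card: "card D = card E"
begin

lemma relabel_in: "x \<in> D \<Longrightarrow> relabel D E x \<in> E"
  unfolding relabel_def using rank_less_card[of D x] fin card by (simp add: finite_enumerate_in_set)

lemma relabel_less: "x \<in> D \<Longrightarrow> y \<in> D \<Longrightarrow> relabel D E x < relabel D E y \<longleftrightarrow> x < y"
  using rank_less_card[of D x] rank_less_card[of D y] rank_strict_mono[of D x y]
    rank_strict_mono[of D y x] fin card
  unfolding relabel_def by (metis finite_enumerate_mono_iff less_asym linorder_neqE_nat)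

lemma relabel_le: "x \<in> D \<Longrightarrow> y \<in> D \<Longrightarrow> relabel D E x \<le> relabel D E y \<longleftrightarrow> x \<le> y"
  using relabel_less[of y x] by (simp flip: not_less)

end

text \<open>Sending \<open>u p\<close> to \<open>v p\<close> is well defined and injective.\<close>

lemma card_image_same_kernel:
  assumes "\<And>p q. p \<in> P \<Longrightarrow> q \<in> P \<Longrightarrow> u p = u q \<longleftrightarrow> v p = v q"
  shows "card (u ` P) = card (v ` P)"
proof -
  have inv: "v (inv_into P u (u p)) = v p" if "p \<in> P" for p
    using assms[of "inv_into P u (u p)" p] that
    by (simp add: f_inv_into_f inv_into_into)
  have "inj_on (v \<circ> inv_into P u) (u ` P)"
    using inv assms by (auto simp: inj_on_def)
  moreover have "(v \<circ> inv_into P u) ` u ` P = v ` P"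
    using inv by (force simp: image_iff)
  ultimately show ?thesis
    by (metis card_image)
qed

text \<open>When \<open>u\<close> and \<open>v\<close> order \<open>P\<close> alike, sending
  \<open>u p\<close> to \<open>v p\<close> is an order isomorphism of the images. Counting the
  values below shows equal ranks, so \<open>relabel\<close> is that map.\<close>

lemma relabel_cong:
  fixes u v :: "'p \<Rightarrow> nat"
  assumes "finite P" and le: "\<And>p q. p \<in> P \<Longrightarrow> q \<in> P \<Longrightarrow> u p \<le> u q \<longleftrightarrow> v p \<le> v q"
  shows "card (u ` P) = card (v ` P)" "p \<in> P \<Longrightarrow> relabel (u ` P) (v ` P) (u p) = v p"
proof -
  have eq: "u p = u q \<longleftrightarrow> v p = v q" if "p \<in> P" "q \<in> P" for p q
    using le[OF that] le[OF that(2,1)] by (metis order.antisym order.refl)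
  then show "card (u ` P) = card (v ` P)"
    by (rule card_image_same_kernel)
  assume p: "p \<in> P"
  have "{y \<in> u ` P. y < u p} = u ` {q \<in> P. u q < u p}" "{y \<in> v ` P. y < v p} = v ` {q \<in> P. v q < v p}"
    by auto
  moreover have "{q \<in> P. u q < u p} = {q \<in> P. v q < v p}"
    using le p by (auto simp flip: not_le)
  moreover have "card (u ` {q \<in> P. v q < v p}) = card (v ` {q \<in> P. v q < v p})"
    by (rule card_image_same_kernel) (use eq in auto)
  ultimately have "rank (u ` P) (u p) = rank (v ` P) (v p)"
    by (simp add: rank_def)
  then show "relabel (u ` P) (v ` P) (u p) = v p"
    using assms(1) p by (simp add: relabel_def enumerate_rank)
qed

text \<open>The key counts the elements strictly below, so exactly the minimal elements get
  0.\<close>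

lemma finite_total_preorder_nat_key:
  assumes "finite P" and r: "preorder_on P r" "total_on P r"
  obtains f :: "'p \<Rightarrow> nat"
  where "\<And>p q. p \<in> P \<Longrightarrow> q \<in> P \<Longrightarrow> (p, q) \<in> r \<longleftrightarrow> f p \<le> f q"
    "\<And>p. f p = 0 \<longleftrightarrow> (\<forall>q\<in>P. (q, p) \<in> r \<longrightarrow> (p, q) \<in> r)"
proof -
  let ?below = "\<lambda>p. {q \<in> P. (q, p) \<in> r \<and> (p, q) \<notin> r}"
  have refl: "(p, p) \<in> r" if "p \<in> P" for p
    using r(1) that by (auto simp: preorder_on_def refl_on_def)
  have trans: "(p, s) \<in> r" if "(p, q) \<in> r" "(q, s) \<in> r" for p q s
    using r(1) that unfolding preorder_on_def by (meson transD)
  have fin: "finite (?below p)" for p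
    using assms(1) by simp
  have "(p, q) \<in> r \<longleftrightarrow> card (?below p) \<le> card (?below q)" if pq: "p \<in> P" "q \<in> P" for p q
  proof
    assume "(p, q) \<in> r"
    then have "?below p \<subseteq> ?below q"
      using trans by blast
    then show "card (?below p) \<le> card (?below q)"
      by (rule card_mono[OF fin])
  next
    assume le: "card (?below p) \<le> card (?below q)"
    show "(p, q) \<in> r"
    proof (rule ccontr)
      assume not: "(p, q) \<notin> r"
      then have "(q, p) \<in> r"
        using r(2) pq refl by (metis total_on_def)
      then have "?below q \<subset> ?below p"
        using not trans pq by blast
      then show False
        using psubset_card_mono[OF fin] le by (simp add: not_le[symmetric])
    qed
  qed
  moreover have "card (?below p) = 0 \<longleftrightarrow> (\<forall>q\<in>P. (q, p) \<in> r \<longrightarrow> (p, q) \<in> r)" for p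
    using fin by auto
  ultimately show thesis
    by (rule that)
qed

section \<open>Echeloned spaces and partition arrows\<close>

text \<open>The echelon becomes the comparison of values of a symmetric distance, and the order the
  comparison of positions, so that order isomorphisms between sets of numbers apply.\<close>

definition coded :: "'b ord_ech_struct \<Rightarrow> ('b \<Rightarrow> nat) \<Rightarrow> ('b \<Rightarrow> 'b \<Rightarrow> nat) \<Rightarrow> bool" where
  "coded A \<kappa> \<delta> \<longleftrightarrow> inj_on \<kappa> (points A) \<and>
     (\<forall>x\<in>points A. \<forall>y\<in>points A. (x, y) \<in> ord A \<longleftrightarrow> \<kappa> x \<le> \<kappa> y) \<and>
     (\<forall>x\<in>points A. \<forall>y\<in>points A. \<forall>z\<in>points A. \<forall>w\<in>points A.
        ((x, y), (z, w)) \<in> ech A \<longleftrightarrow> \<delta> x y \<le> \<delta> z w) \<and>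
     (\<forall>x\<in>points A. \<forall>y\<in>points A. \<delta> x y = \<delta> y x) \<and>
     (\<forall>x\<in>points A. \<forall>y\<in>points A. \<delta> x y = 0 \<longleftrightarrow> x = y)"

text \<open>Diagonal pairs, and by the separation axiom only these, are minimal and get distance 0.
  The symmetry axiom applied both ways round makes the distance symmetric.\<close>

lemma ordered_echeloned_space_coded:
  assumes A: "ordered_echeloned_space A" and fin: "finite (points A)"
  obtains \<kappa> \<delta> where "coded A \<kappa> \<delta>"
proof -
  let ?X = "points A"
  have lin: "preorder_on ?X (ord A)" "total_on ?X (ord A)" "antisym (ord A)"
    using A by (auto simp: ordered_echeloned_space_def linear_order_on_def partial_order_on_def)
  have ech: "preorder_on (?X \<times> ?X) (ech A)" "total_on (?X \<times> ?X) (ech A)"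
    and diag: "\<And>x y z. x \<in> ?X \<Longrightarrow> y \<in> ?X \<Longrightarrow> z \<in> ?X \<Longrightarrow> ((x, x), (y, z)) \<in> ech A"
    and sep: "\<And>x y z. x \<in> ?X \<Longrightarrow> y \<in> ?X \<Longrightarrow> z \<in> ?X \<Longrightarrow> ((y, z), (x, x)) \<in> ech A \<Longrightarrow> y = z"
    and sym: "\<And>x y. x \<in> ?X \<Longrightarrow> y \<in> ?X \<Longrightarrow> ((x, y), (y, x)) \<in> ech A"
    using A by (simp_all add: ordered_echeloned_space_def echeloned_space_def)
  obtain \<kappa> :: "'a \<Rightarrow> nat" where \<kappa>: "\<And>x y. x \<in> ?X \<Longrightarrow> y \<in> ?X \<Longrightarrow> (x, y) \<in> ord A \<longleftrightarrow> \<kappa> x \<le> \<kappa> y"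
    by (rule finite_total_preorder_nat_key[OF fin lin(1,2)]) (rule that)
  obtain f :: "'a \<times> 'a \<Rightarrow> nat" where
    f: "\<And>p q. p \<in> ?X \<times> ?X \<Longrightarrow> q \<in> ?X \<times> ?X \<Longrightarrow> (p, q) \<in> ech A \<longleftrightarrow> f p \<le> f q"
    and f0: "\<And>p. f p = 0 \<longleftrightarrow> (\<forall>q\<in>?X \<times> ?X. (q, p) \<in> ech A \<longrightarrow> (p, q) \<in> ech A)"
    by (rule finite_total_preorder_nat_key[OF finite_cartesian_product[OF fin fin] ech]) (rule that)
  have "inj_on \<kappa> ?X"
    by (rule inj_onI) (use \<kappa> antisymD[OF lin(3)] in auto)
  moreover have "f (x, y) = f (y, x)" if "x \<in> ?X" "y \<in> ?X" for x y
    using f[of "(x, y)" "(y, x)"] f[of "(y, x)" "(x, y)"] sym that by (intro le_antisym) auto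
  moreover have "f (x, y) = 0 \<longleftrightarrow> x = y" if xy: "x \<in> ?X" "y \<in> ?X" for x y
  proof
    assume "f (x, y) = 0"
    then have "((x, y), (x, x)) \<in> ech A"
      using f0[of "(x, y)"] diag xy by blast
    then show "x = y"
      using sep xy by blast
  next
    assume "x = y"
    then show "f (x, y) = 0"
      using f0[of "(x, y)"] diag xy by auto
  qed
  ultimately have "coded A \<kappa> (\<lambda>x y. f (x, y))"
    using \<kappa> f by (simp add: coded_def)
  then show thesis
    by (rule that)
qed

definition struct_of :: "'b set \<Rightarrow> ('b \<Rightarrow> nat) \<Rightarrow> ('b \<Rightarrow> 'b \<Rightarrow> nat) \<Rightarrow> 'b ord_ech_struct" where
  "struct_of V \<kappa> d =
     \<lparr>points = V,
      ech = {((x, y), (z, w)). x \<in> V \<and> y \<in> V \<and> z \<in> V \<and> w \<in> V \<and> d x y \<le> d z w},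
      ord = {(x, y). x \<in> V \<and> y \<in> V \<and> \<kappa> x \<le> \<kappa> y}\<rparr>"

lemma ordered_echeloned_space_struct_of:
  assumes "V \<noteq> {}" "inj_on \<kappa> V"
    and "\<And>x y. x \<in> V \<Longrightarrow> y \<in> V \<Longrightarrow> d x y = d y x"
    and "\<And>x y. x \<in> V \<Longrightarrow> y \<in> V \<Longrightarrow> d x y = 0 \<longleftrightarrow> x = y"
  shows "ordered_echeloned_space (struct_of V \<kappa> d)"
proof -
  let ?C = "struct_of V \<kappa> d"
  have "preorder_on (V \<times> V) (ech ?C)"
    unfolding preorder_on_def refl_on_def trans_def struct_of_def by auto
  moreover have "total_on (V \<times> V) (ech ?C)"
    unfolding total_on_def struct_of_def by auto
  ultimately have "echeloned_space V (ech ?C)"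
    unfolding echeloned_space_def
  proof (intro conjI ballI impI)
    have diag: "d x x = 0" if "x \<in> V" for x
      using assms(4) that by blast
    fix x y z assume xyz: "x \<in> V" "y \<in> V" "z \<in> V"
    then show "((x, x), (y, z)) \<in> ech ?C"
      by (simp add: struct_of_def diag)
    show "y = z" if "((y, z), (x, x)) \<in> ech ?C"
      using that xyz assms(4) by (simp add: struct_of_def diag)
  qed (use assms(1,3) in \<open>auto simp: struct_of_def\<close>)
  moreover have "linear_order_on V (ord ?C)"
    unfolding linear_order_on_def partial_order_on_def preorder_on_def refl_on_def trans_def
      antisym_def total_on_def struct_of_def using assms(2) by (auto simp: inj_on_def)
  ultimately show ?thesis
    by (simp add: ordered_echeloned_space_def struct_of_def)
qed

section \<open>Isomorphisms and the arrow relation\<close>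

lemma isomorphic_sym:
  assumes "isomorphic A B"
  shows "isomorphic B A"
proof -
  obtain f where f: "is_iso f A B"
    using assms by (auto simp: isomorphic_def)
  let ?g = "inv_into (points A) f"
  have bij: "bij_betw f (points A) (points B)"
    using f by (simp add: is_iso_def)
  have g: "?g y \<in> points A" "f (?g y) = y" if "y \<in> points B" for y
    using bij that by (auto simp: bij_betw_def f_inv_into_f inv_into_into)
  have "is_iso ?g B A"
    using f g bij_betw_inv_into[OF bij] unfolding is_iso_def by metis
  then show ?thesis
    by (auto simp: isomorphic_def)
qed

lemma isomorphic_trans:
  assumes "isomorphic A B" "isomorphic B C"
  shows "isomorphic A C"
proof -
  obtain f g where f: "is_iso f A B" and g: "is_iso g B C"
    using assms by (auto simp: isomorphic_def)
  have "f x \<in> points B" if "x \<in> points A" for x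
    using f that by (auto simp: is_iso_def bij_betw_def)
  moreover have "bij_betw (g \<circ> f) (points A) (points C)"
    using f g by (meson bij_betw_trans is_iso_def)
  ultimately have "is_iso (g \<circ> f) A C"
    using f g by (simp add: is_iso_def)
  then show ?thesis
    by (auto simp: isomorphic_def)
qed

lemma induced_induced: "S \<subseteq> T \<Longrightarrow> induced (induced C T) S = induced C S"
  by (auto simp: induced_def)

lemma isomorphic_induced_image:
  assumes f: "is_iso f A B" and S: "S \<subseteq> points A"
  shows "isomorphic (induced A S) (induced B (f ` S))"
proof -
  have "bij_betw f S (f ` S)"
    using f S by (auto simp: is_iso_def bij_betw_def intro: inj_on_subset)
  then have "is_iso f (induced A S) (induced B (f ` S))"
    using f S unfolding is_iso_def induced_def by (simp add: subset_iff)
  then show ?thesis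
    by (auto simp: isomorphic_def)
qed

text \<open>Copies are represented by their point sets and partitions by colourings, which frees the
  relation from the types of \<open>A\<close> and \<open>B\<close>. The bound \<open>i < k\<close>
  is separate because \<open>T\<close> may contain no copy of \<open>A\<close>.\<close>

definition arrow :: "nat \<Rightarrow> 'c ord_ech_struct \<Rightarrow> 'b ord_ech_struct \<Rightarrow> 'a ord_ech_struct \<Rightarrow> bool" where
  "arrow k C B A \<longleftrightarrow> (\<forall>\<chi>. range \<chi> \<subseteq> {..<k} \<longrightarrow>
     (\<exists>T i. T \<subseteq> points C \<and> T \<noteq> {} \<and> isomorphic (induced C T) B \<and> i < k \<and>
       (\<forall>S. S \<subseteq> T \<and> S \<noteq> {} \<and> isomorphic (induced C S) A \<longrightarrow> \<chi> S = i)))"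

text \<open>A colouring for \<open>C'\<close> is pulled back along an isomorphism from
  \<open>C\<close>. This transports the arrow from the class to the age of its limit.\<close>

lemma arrow_isomorphic:
  fixes C :: "'c ord_ech_struct" and C' :: "'d ord_ech_struct"
  assumes arr: "arrow k C B A" and C: "isomorphic C C'" and B: "isomorphic B B'"
    and A: "isomorphic A A'"
  shows "arrow k C' B' A'"
  unfolding arrow_def
proof (intro allI impI)
  fix \<chi> :: "'d set \<Rightarrow> nat"
  assume \<chi>: "range \<chi> \<subseteq> {..<k}"
  obtain f where f: "is_iso f C C'"
    using C by (auto simp: isomorphic_def)
  have "range (\<lambda>S. \<chi> (f ` S)) \<subseteq> {..<k}"
    using \<chi> by auto
  from arr[unfolded arrow_def, rule_format, OF this] obtain T i
    where T: "T \<subseteq> points C" "T \<noteq> {}" "isomorphic (induced C T) B" and i: "i < k"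
      and mono: "\<forall>S. S \<subseteq> T \<and> S \<noteq> {} \<and> isomorphic (induced C S) A \<longrightarrow> \<chi> (f ` S) = i"
    by (elim exE conjE) (rule that)
  have "f ` T \<subseteq> points C'"
    using T f by (auto simp: is_iso_def bij_betw_def)
  moreover have "isomorphic (induced C' (f ` T)) B'"
    using isomorphic_induced_image[OF f T(1)] T(3) B isomorphic_sym isomorphic_trans by metis
  moreover have "\<chi> S = i" if S: "S \<subseteq> f ` T" "S \<noteq> {}" "isomorphic (induced C' S) A'" for S
  proof -
    obtain R where R: "R \<subseteq> T" "S = f ` R"
      using S(1) by (auto simp: subset_image_iff)
    have "isomorphic (induced C R) (induced C' S)"
      unfolding R(2) using R(1) T(1) by (intro isomorphic_induced_image[OF f]) auto
    then have "isomorphic (induced C R) A"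
      using S(3) A isomorphic_sym isomorphic_trans by metis
    then show ?thesis
      using mono[rule_format, of R] R S(2) by auto
  qed
  ultimately show "\<exists>T i. T \<subseteq> points C' \<and> T \<noteq> {} \<and> isomorphic (induced C' T) B' \<and> i < k \<and>
      (\<forall>S. S \<subseteq> T \<and> S \<noteq> {} \<and> isomorphic (induced C' S) A' \<longrightarrow> \<chi> S = i)"
    using T(2) i by (intro exI[of _ "f ` T"] exI[of _ i]) auto
qed

lemma ramsey_class_if_arrow:
  assumes arr: "\<And>A B k. A \<in> K \<Longrightarrow> B \<in> K \<Longrightarrow> k \<ge> 1 \<Longrightarrow> \<exists>C\<in>K. arrow k C B A"
  shows "ramsey_class K"
  unfolding ramsey_class_def
proof (intro ballI allI impI)
  fix A B :: "'a ord_ech_struct" and k :: nat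
  assume "A \<in> K" "B \<in> K" "k \<ge> 1"
  then obtain C where C: "C \<in> K" "arrow k C B A"
    using arr by blast
  show "\<exists>C\<in>K. \<forall>P. disjoint_family_on P {..<k} \<and> (\<Union>i<k. P i) = copies C A \<longrightarrow>
      (\<exists>B'\<in>copies C B. \<exists>i<k. copies B' A \<subseteq> P i)"
  proof (intro bexI[OF _ C(1)] allI impI)
    fix P :: "nat \<Rightarrow> 'a ord_ech_struct set"
    assume "disjoint_family_on P {..<k} \<and> (\<Union>i<k. P i) = copies C A"
    then have P: "(\<Union>i<k. P i) = copies C A" ..
    \<comment> \<open>The colour of \<open>S\<close> is the index of a class containing its induced
      substructure; sets outside all classes get 0, a legal colour because
      \<open>k \<ge> 1\<close>.\<close>
    define \<chi> where "\<chi> S = (if \<exists>i<k. induced C S \<in> P i then SOME i. i < k \<and> induced C S \<in> P i else 0)"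
      for S
    have \<chi>: "\<chi> S < k \<and> induced C S \<in> P (\<chi> S)" if "\<exists>i<k. induced C S \<in> P i" for S
      using someI_ex[OF that] that by (simp add: \<chi>_def)
    have "range \<chi> \<subseteq> {..<k}"
      using \<chi> \<open>k \<ge> 1\<close> by (auto simp: \<chi>_def)
    from C(2)[unfolded arrow_def, rule_format, OF this] obtain T i
      where T: "T \<subseteq> points C" "T \<noteq> {}" "isomorphic (induced C T) B" and i: "i < k"
      and mono: "\<forall>S. S \<subseteq> T \<and> S \<noteq> {} \<and> isomorphic (induced C S) A \<longrightarrow> \<chi> S = i"
      by (elim exE conjE) (rule that)
    have "induced C T \<in> copies C B"
      using T by (auto simp: copies_def substructures_def)
    moreover have "A' \<in> P i" if A': "A' \<in> copies (induced C T) A" for A'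
    proof -
      obtain S where "S \<subseteq> points (induced C T)" "S \<noteq> {}" "A' = induced (induced C T) S"
        "isomorphic A' A"
        using A' by (auto simp: copies_def substructures_def)
      moreover have "points (induced C T) = T"
        by (simp add: induced_def)
      ultimately have S: "S \<subseteq> T" "S \<noteq> {}" "A' = induced C S" "isomorphic (induced C S) A"
        by (simp_all add: induced_induced)
      then have "induced C S \<in> copies C A"
        unfolding copies_def substructures_def mem_Collect_eq
        by (intro conjI exI[of _ S]) (use T(1) in auto)
      then show ?thesis
        using \<chi>[of S] mono[rule_format, of S] S P by auto
    qed
    ultimately show "\<exists>B'\<in>copies C B. \<exists>i<k. copies B' A \<subseteq> P i"
      using i by blast
  qed
qed

section \<open>Ramsey's theorem for pairs of sets\<close>

lemma finite_ramsey:
  "\<exists>N. \<forall>f :: nat set \<Rightarrow> nat. range f \<subseteq> {..<k} \<longrightarrow>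
    (\<exists>E d. E \<subseteq> {..<N} \<and> card E = b \<and> d < k \<and> (\<forall>e. e \<subseteq> E \<and> card e = a \<longrightarrow> f e = d))"
proof -
  obtain N :: nat where N: "partn_lst {..<N} (replicate k b) a"
    using ramsey_full by blast
  have "\<exists>E d. E \<subseteq> {..<N} \<and> card E = b \<and> d < k \<and> (\<forall>e. e \<subseteq> E \<and> card e = a \<longrightarrow> f e = d)"
    if f: "range f \<subseteq> {..<k}" for f :: "nat set \<Rightarrow> nat"
  proof -
    have "f \<in> nsets {..<N} a \<rightarrow> {..<k}"
      using f by auto
    then obtain d E where d: "d < k" and E: "E \<in> nsets {..<N} b" and mono: "f ` nsets E a \<subseteq> {d}"
      using N by (auto simp: partn_lst_def monochromatic_def)
    have "f e = d" if "e \<subseteq> E" "card e = a" for e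
    proof -
      have "e \<in> nsets E a"
        using E that by (auto simp: nsets_def intro: finite_subset)
      then show ?thesis
        using mono by auto
    qed
    then show ?thesis
      using d E by (auto simp: nsets_def)
  qed
  then show ?thesis
    by blast
qed

text \<open>\<open>N\<close> is chosen first, so that the rows \<open>f (e, _)\<close> on subsets of
  \<open>{..<N}\<close> form finitely many colours for the choice of \<open>p\<close>. All relevant
  \<open>e\<close> inside \<open>E\<close> then have the same row, and Ramsey's theorem for this row
  finishes.\<close>

lemma finite_product_ramsey:
  "\<exists>p N. \<forall>f :: nat set \<times> nat set \<Rightarrow> nat. range f \<subseteq> {..<k} \<longrightarrow>
    (\<exists>E \<psi> d. E \<subseteq> {..<p} \<and> card E = b \<and> \<psi> \<subseteq> {..<N} \<and> card \<psi> = n \<and> d < k \<and>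
      (\<forall>e \<phi>. e \<subseteq> E \<and> card e = a \<and> \<phi> \<subseteq> \<psi> \<and> card \<phi> = m \<longrightarrow> f (e, \<phi>) = d))"
proof -
  obtain N where N: "\<And>f :: nat set \<Rightarrow> nat. range f \<subseteq> {..<k} \<Longrightarrow>
    \<exists>\<psi> d. \<psi> \<subseteq> {..<N} \<and> card \<psi> = n \<and> d < k \<and> (\<forall>\<phi>. \<phi> \<subseteq> \<psi> \<and> card \<phi> = m \<longrightarrow> f \<phi> = d)"
    using finite_ramsey[of k n m] by blast
  obtain \<phi>s where \<phi>s: "set \<phi>s = Pow {..<N}"
    using finite_list[of "Pow {..<N}"] by auto
  have "finite (list_encode ` words {..<k} (length \<phi>s))"
    by (simp add: finite_words)
  then obtain K where K: "list_encode ` words {..<k} (length \<phi>s) \<subseteq> {..<K}"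
    using finite_nat_bounded by blast
  obtain p where p: "\<And>f :: nat set \<Rightarrow> nat. range f \<subseteq> {..<K} \<Longrightarrow>
    \<exists>E d. E \<subseteq> {..<p} \<and> card E = b \<and> d < K \<and> (\<forall>e. e \<subseteq> E \<and> card e = a \<longrightarrow> f e = d)"
    using finite_ramsey[of K b a] by blast
  have "\<exists>E \<psi> d. E \<subseteq> {..<p} \<and> card E = b \<and> \<psi> \<subseteq> {..<N} \<and> card \<psi> = n \<and> d < k \<and>
      (\<forall>e \<phi>. e \<subseteq> E \<and> card e = a \<and> \<phi> \<subseteq> \<psi> \<and> card \<phi> = m \<longrightarrow> f (e, \<phi>) = d)"
    if f: "range f \<subseteq> {..<k}" for f :: "nat set \<times> nat set \<Rightarrow> nat"
  proof -
    let ?code = "\<lambda>e. list_encode (map (\<lambda>\<phi>. f (e, \<phi>)) \<phi>s)"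
    have "map (\<lambda>\<phi>. f (e, \<phi>)) \<phi>s \<in> words {..<k} (length \<phi>s)" for e
      using f by (auto simp: words_def)
    then have "range ?code \<subseteq> {..<K}"
      using K by blast
    from p[OF this] obtain E d0 where E: "E \<subseteq> {..<p}" "card E = b"
      and d0: "\<forall>e. e \<subseteq> E \<and> card e = a \<longrightarrow> ?code e = d0"
      by (elim exE conjE) (rule that)
    \<comment> \<open>A representative of the common row. If \<open>E\<close> has no subset of size
      \<open>a\<close>, it is arbitrary and the claim is vacuous.\<close>
    define e0 where "e0 = (SOME e. e \<subseteq> E \<and> card e = a)"
    have "range (\<lambda>\<phi>. f (e0, \<phi>)) \<subseteq> {..<k}"
      using f by auto
    from N[OF this] obtain \<psi> d where \<psi>: "\<psi> \<subseteq> {..<N}" "card \<psi> = n" "d < k"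
      and d: "\<forall>\<phi>. \<phi> \<subseteq> \<psi> \<and> card \<phi> = m \<longrightarrow> f (e0, \<phi>) = d"
      by (elim exE conjE) (rule that)
    have "f (e, \<phi>) = d" if e: "e \<subseteq> E" "card e = a" and \<phi>: "\<phi> \<subseteq> \<psi>" "card \<phi> = m" for e \<phi>
    proof -
      have "e0 \<subseteq> E \<and> card e0 = a"
        unfolding e0_def by (rule someI[of _ e]) (use e in auto)
      then have "?code e = ?code e0"
        using d0 e by simp
      then have "map (\<lambda>\<phi>. f (e, \<phi>)) \<phi>s = map (\<lambda>\<phi>. f (e0, \<phi>)) \<phi>s"
        by (simp only: list_encode_eq)
      moreover have "\<phi> \<in> set \<phi>s"
        using \<phi>(1) \<psi>(1) \<phi>s by auto
      ultimately have "f (e, \<phi>) = f (e0, \<phi>)"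
        by (simp only: map_eq_conv)
      then show ?thesis
        using d \<phi> by simp
    qed
    then show ?thesis
      using E \<psi> by (intro exI[of _ E] exI[of _ \<psi>] exI[of _ d]) simp
  qed
  then show ?thesis
    by (intro exI[of _ p] exI[of _ N] allI impI)
qed

section \<open>Ordered echeloned spaces from partite systems\<close>

definition increasing_pairs :: "('b \<Rightarrow> nat) \<Rightarrow> 'b set \<Rightarrow> ('b \<times> 'b) set" where
  "increasing_pairs \<pi> S = {p \<in> S \<times> S. \<pi> (fst p) < \<pi> (snd p)}"

definition labels :: "('b \<Rightarrow> nat) \<Rightarrow> ('b \<Rightarrow> 'b \<Rightarrow> nat) \<Rightarrow> 'b set \<Rightarrow> nat set" where
  "labels \<pi> c S = (\<lambda>p. c (fst p) (snd p)) ` increasing_pairs \<pi> S"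

text \<open>The labelling of the set of parts \<open>e\<close> for which a transversal over \<open>e\<close> with label set \<open>\<phi>\<close> is
  isomorphic to \<open>A\<close>.\<close>

definition pattern ::
  "'b ord_ech_struct \<Rightarrow> ('b \<Rightarrow> nat) \<Rightarrow> ('b \<Rightarrow> 'b \<Rightarrow> nat) \<Rightarrow> nat set \<Rightarrow> nat set \<Rightarrow> nat \<Rightarrow> nat \<Rightarrow> nat" where
  "pattern A \<kappa> \<delta> e \<phi> i j =
     relabel (labels \<kappa> \<delta> (points A)) \<phi>
       (\<delta> (inv_into (points A) \<kappa> (relabel e (\<kappa> ` points A) i))
          (inv_into (points A) \<kappa> (relabel e (\<kappa> ` points A) j)))"

text \<open>Labels are shifted by one to reserve 0 for the diagonal. Distinct points of one part get
  the arbitrary distance 1; no transversal contains such a pair.\<close>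

definition part_dist :: "('b \<Rightarrow> nat) \<Rightarrow> ('b \<Rightarrow> 'b \<Rightarrow> nat) \<Rightarrow> 'b \<Rightarrow> 'b \<Rightarrow> nat" where
  "part_dist \<pi> c x y =
     (if x = y then 0 else if \<pi> x < \<pi> y then Suc (c x y) else if \<pi> y < \<pi> x then Suc (c y x) else 1)"

lemma part_dist_less: "\<pi> x < \<pi> y \<Longrightarrow> part_dist \<pi> c x y = Suc (c x y)"
  by (auto simp: part_dist_def)

lemma finite_increasing_pairs: "finite S \<Longrightarrow> finite (increasing_pairs \<pi> S)"
  by (simp add: increasing_pairs_def)

lemma finite_labels: "finite S \<Longrightarrow> finite (labels \<pi> c S)"
  by (simp add: labels_def finite_increasing_pairs)

lemma labelsI: "x \<in> S \<Longrightarrow> y \<in> S \<Longrightarrow> \<pi> x < \<pi> y \<Longrightarrow> c x y \<in> labels \<pi> c S"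
  by (force simp: labels_def increasing_pairs_def)

text \<open>\<open>key\<close> refines the order of the parts to a linear order of all points. Its
  choice within a part does not affect sets with at most one point per part.\<close>

locale partite_structure =
  fixes V :: "'v set" and \<pi> :: "'v \<Rightarrow> nat" and c :: "'v \<Rightarrow> 'v \<Rightarrow> nat" and key :: "'v \<Rightarrow> nat"
  assumes inj_key: "inj_on key V"
    and key_less: "\<And>x y. x \<in> V \<Longrightarrow> y \<in> V \<Longrightarrow> \<pi> x < \<pi> y \<Longrightarrow> key x < key y"
begin

definition struct :: "'v ord_ech_struct" where
  "struct = struct_of V key (part_dist \<pi> c)"

lemma points_struct: "points struct = V"
  by (simp add: struct_def struct_of_def)

lemma ordered_echeloned_space_struct: "V \<noteq> {} \<Longrightarrow> ordered_echeloned_space struct"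
  unfolding struct_def
  by (rule ordered_echeloned_space_struct_of) (auto simp: inj_key part_dist_def)

lemma induced_struct:
  assumes S: "S \<subseteq> V" "inj_on \<pi> S"
  shows "x \<in> S \<Longrightarrow> y \<in> S \<Longrightarrow> (x, y) \<in> ord (induced struct S) \<longleftrightarrow> \<pi> x \<le> \<pi> y"
    and "x \<in> S \<Longrightarrow> y \<in> S \<Longrightarrow> z \<in> S \<Longrightarrow> w \<in> S \<Longrightarrow>
      ((x, y), (z, w)) \<in> ech (induced struct S) \<longleftrightarrow> part_dist \<pi> c x y \<le> part_dist \<pi> c z w"
    and "points (induced struct S) = S"
proof -
  have "key x \<le> key y \<longleftrightarrow> \<pi> x \<le> \<pi> y" if xy: "x \<in> S" "y \<in> S" for x y
  proof (cases "\<pi> x" "\<pi> y" rule: linorder_cases)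
    case less
    then show ?thesis
      using key_less[of x y] S(1) xy by (auto simp: subset_iff)
  next
    case equal
    then show ?thesis
      using S xy by (metis inj_onD order_refl)
  next
    case greater
    then show ?thesis
      using key_less[of y x] S(1) xy by (auto simp: subset_iff)
  qed
  then show "x \<in> S \<Longrightarrow> y \<in> S \<Longrightarrow> (x, y) \<in> ord (induced struct S) \<longleftrightarrow> \<pi> x \<le> \<pi> y"
    using S by (auto simp: induced_def struct_def struct_of_def)
  show "x \<in> S \<Longrightarrow> y \<in> S \<Longrightarrow> z \<in> S \<Longrightarrow> w \<in> S \<Longrightarrow>
      ((x, y), (z, w)) \<in> ech (induced struct S) \<longleftrightarrow> part_dist \<pi> c x y \<le> part_dist \<pi> c z w"
    using S by (auto simp: induced_def struct_def struct_of_def)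
  show "points (induced struct S) = S"
    by (simp add: induced_def)
qed

text \<open>An isomorphism matches comparisons of parts with those of positions, and comparisons of
  labels with those of distances. Both order isomorphisms are thereby forced, so the parts and the
  label set of \<open>S\<close> determine its labelling.\<close>

lemma isomorphic_imp_transversal:
  assumes A: "coded A \<kappa> \<delta>" and S: "finite S" "S \<subseteq> V" "inj_on \<pi> S"
    and iso: "isomorphic (induced struct S) A"
  shows "card (\<pi> ` S) = card (\<kappa> ` points A)"
    and "card (labels \<pi> c S) = card (labels \<kappa> \<delta> (points A))"
    and "S \<in> transversals V \<pi> c (\<pi> ` S) (pattern A \<kappa> \<delta> (\<pi> ` S) (labels \<pi> c S))"
proof -
  obtain f where f: "is_iso f (induced struct S) A"
    using iso by (auto simp: isomorphic_def)
  have bij: "bij_betw f S (points A)"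
    using f induced_struct(3)[OF S(2,3)] by (simp add: is_iso_def)
  have fS: "f x \<in> points A" if "x \<in> S" for x
    using bij that by (auto simp: bij_betw_def)
  have ord: "\<pi> x \<le> \<pi> y \<longleftrightarrow> \<kappa> (f x) \<le> \<kappa> (f y)" if "x \<in> S" "y \<in> S" for x y
    using f induced_struct(1,3)[OF S(2,3)] that A fS by (simp add: is_iso_def coded_def)
  have ech: "part_dist \<pi> c x y \<le> part_dist \<pi> c z w \<longleftrightarrow> \<delta> (f x) (f y) \<le> \<delta> (f z) (f w)"
    if "x \<in> S" "y \<in> S" "z \<in> S" "w \<in> S" for x y z w
    using f induced_struct(2,3)[OF S(2,3)] that A fS by (simp add: is_iso_def coded_def)
  have img: "\<kappa> ` points A = (\<lambda>x. \<kappa> (f x)) ` S"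
    using bij by (simp add: bij_betw_def image_image flip: bij_betw_imp_surj_on[OF bij])
  note points = relabel_cong[of S \<pi> "\<lambda>x. \<kappa> (f x)", OF S(1) ord, folded img]
  show "card (\<pi> ` S) = card (\<kappa> ` points A)"
    by (rule points(1))
  \<comment> \<open>Thus the points of \<open>A\<close> that \<open>pattern\<close> looks up for the
    parts of \<open>S\<close> are the images under \<open>f\<close>.\<close>
  have pos: "inv_into (points A) \<kappa> (relabel (\<pi> ` S) (\<kappa> ` points A) (\<pi> x)) = f x" if "x \<in> S" for x
    using points(2)[OF _ _ that] A fS[OF that] by (simp add: coded_def)
  have "increasing_pairs \<kappa> (points A) = map_prod f f ` increasing_pairs \<pi> S"
  proof -
    have A_eq: "points A = f ` S"
      using bij by (simp add: bij_betw_def)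
    have less: "\<pi> x < \<pi> y \<longleftrightarrow> \<kappa> (f x) < \<kappa> (f y)" if "x \<in> S" "y \<in> S" for x y
      using ord[OF that(2,1)] by (simp add: not_le[symmetric])
    then show ?thesis
      unfolding A_eq increasing_pairs_def by (auto simp: image_iff)
  qed
  then have img2: "labels \<kappa> \<delta> (points A) = (\<lambda>p. \<delta> (f (fst p)) (f (snd p))) ` increasing_pairs \<pi> S"
    by (auto simp: labels_def image_image)
  have le: "\<delta> (f (fst p)) (f (snd p)) \<le> \<delta> (f (fst q)) (f (snd q)) \<longleftrightarrow>
      c (fst p) (snd p) \<le> c (fst q) (snd q)"
    if "p \<in> increasing_pairs \<pi> S" "q \<in> increasing_pairs \<pi> S" for p q
  proof -
    have p: "fst p \<in> S" "snd p \<in> S" "\<pi> (fst p) < \<pi> (snd p)"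
      and q: "fst q \<in> S" "snd q \<in> S" "\<pi> (fst q) < \<pi> (snd q)"
      using that by (auto simp: increasing_pairs_def)
    show ?thesis
      using ech[OF p(1,2) q(1,2)] unfolding part_dist_less[of \<pi>, OF p(3)] part_dist_less[of \<pi>, OF q(3)] by simp
  qed
  \<comment> \<open>For labels the order isomorphism runs from \<open>A\<close> to \<open>S\<close>,
    for parts from \<open>S\<close> to \<open>A\<close>; these are the directions used in
    \<open>pattern\<close>.\<close>
  note dists = relabel_cong[of "increasing_pairs \<pi> S" "\<lambda>p. \<delta> (f (fst p)) (f (snd p))"
      "\<lambda>p. c (fst p) (snd p)", OF finite_increasing_pairs[OF S(1)] le, folded img2 labels_def]
  show "card (labels \<pi> c S) = card (labels \<kappa> \<delta> (points A))"
    using dists(1) by simp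
  have "c x y = pattern A \<kappa> \<delta> (\<pi> ` S) (labels \<pi> c S) (\<pi> x) (\<pi> y)"
    if "x \<in> S" "y \<in> S" "\<pi> x < \<pi> y" for x y
    using dists(2)[of "(x, y)"] that by (simp add: pattern_def pos increasing_pairs_def)
  then show "S \<in> transversals V \<pi> c (\<pi> ` S) (pattern A \<kappa> \<delta> (\<pi> ` S) (labels \<pi> c S))"
    using S by (simp add: transversals_def bij_betw_def)
qed

text \<open>Order isomorphisms of positions and of labels leave all comparisons unchanged, so any
  admissible choice of parts and labels gives a copy of \<open>B\<close>.\<close>

lemma isomorphic_relabelled:
  assumes B: "coded B \<kappa> \<delta>" "finite (points B)"
    and E: "finite E" "card (\<kappa> ` points B) = card E"
    and \<psi>: "finite \<psi>" "card (labels \<kappa> \<delta> (points B)) = card \<psi>"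
    and H: "H ` points B \<subseteq> V"
    and part: "\<And>x. x \<in> points B \<Longrightarrow> \<pi> (H x) = relabel (\<kappa> ` points B) E (\<kappa> x)"
    and label: "\<And>x y. x \<in> points B \<Longrightarrow> y \<in> points B \<Longrightarrow> \<kappa> x < \<kappa> y \<Longrightarrow>
      c (H x) (H y) = relabel (labels \<kappa> \<delta> (points B)) \<psi> (\<delta> x y)"
  shows "inj_on \<pi> (H ` points B)" "isomorphic (induced struct (H ` points B)) B"
proof -
  have inj_\<kappa>: "inj_on \<kappa> (points B)"
    and sym: "\<And>x y. x \<in> points B \<Longrightarrow> y \<in> points B \<Longrightarrow> \<delta> x y = \<delta> y x"
    and zero: "\<And>x y. x \<in> points B \<Longrightarrow> y \<in> points B \<Longrightarrow> \<delta> x y = 0 \<longleftrightarrow> x = y"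
    using B(1) by (simp_all add: coded_def)
  have ord: "\<pi> (H x) \<le> \<pi> (H y) \<longleftrightarrow> \<kappa> x \<le> \<kappa> y" if "x \<in> points B" "y \<in> points B" for x y
    unfolding part[OF that(1)] part[OF that(2)]
    by (rule relabel_le) (use B(2) E that in auto)
  have eq: "\<pi> (H x) = \<pi> (H y) \<longleftrightarrow> x = y" if "x \<in> points B" "y \<in> points B" for x y
    using ord[OF that] ord[OF that(2,1)] inj_\<kappa> that by (metis inj_onD le_antisym order_refl)
  show inj: "inj_on \<pi> (H ` points B)"
    using eq by (auto simp: inj_on_def)
  have bij: "bij_betw H (points B) (H ` points B)"
    unfolding bij_betw_def by (intro conjI inj_onI refl) (metis eq)
  let ?D = "labels \<kappa> \<delta> (points B)"
  \<comment> \<open>\<open>labels\<close> collects increasing pairs only; symmetry of the distance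
    covers the decreasing ones.\<close>
  have mem: "\<delta> x y \<in> ?D" if xy: "x \<in> points B" "y \<in> points B" "x \<noteq> y" for x y
  proof (cases "\<kappa> x < \<kappa> y")
    case True
    then show ?thesis
      using xy by (simp add: labelsI)
  next
    case False
    then have "\<kappa> y < \<kappa> x"
      using xy inj_\<kappa> by (metis inj_onD linorder_neqE_nat)
    then show ?thesis
      using xy sym[of x y] by (simp add: labelsI)
  qed
  have dist: "part_dist \<pi> c (H x) (H y) = (if \<delta> x y = 0 then 0 else Suc (relabel ?D \<psi> (\<delta> x y)))"
    if xy: "x \<in> points B" "y \<in> points B" for x y
  proof (cases "\<kappa> x" "\<kappa> y" rule: linorder_cases)
    case less
    then have "\<pi> (H x) < \<pi> (H y)" "x \<noteq> y"
      using ord[OF xy(2,1)] by auto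
    then show ?thesis
      using label[OF xy less] zero[OF xy] by (auto simp: part_dist_def)
  next
    case equal
    then have "x = y"
      using inj_\<kappa> xy by (metis inj_onD)
    then show ?thesis
      using zero[OF xy] by (simp add: part_dist_def)
  next
    case greater
    then have "\<pi> (H y) < \<pi> (H x)" "x \<noteq> y"
      using ord[OF xy] by auto
    then show ?thesis
      using label[OF xy(2,1) greater] zero[OF xy] sym[OF xy] by (auto simp: part_dist_def)
  qed
  have ech: "part_dist \<pi> c (H x) (H y) \<le> part_dist \<pi> c (H z) (H w) \<longleftrightarrow> \<delta> x y \<le> \<delta> z w"
    if xy: "x \<in> points B" "y \<in> points B" and zw: "z \<in> points B" "w \<in> points B" for x y z w
  proof (cases "x = y \<or> z = w")
    case True
    then show ?thesis
      using dist[OF xy] dist[OF zw] zero[OF xy] zero[OF zw] by auto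
  next
    case False
    then have "relabel ?D \<psi> (\<delta> x y) \<le> relabel ?D \<psi> (\<delta> z w) \<longleftrightarrow> \<delta> x y \<le> \<delta> z w"
      using relabel_le[OF finite_labels[OF B(2)] \<psi> mem[OF xy] mem[OF zw]] by simp
    then show ?thesis
      using False dist[OF xy] dist[OF zw] zero[OF xy] zero[OF zw] by simp
  qed
  have "is_iso H B (induced struct (H ` points B))"
    unfolding is_iso_def induced_struct(3)[OF H inj]
    using bij ord ech B(1) induced_struct(1,2)[OF H inj] by (simp add: coded_def)
  then show "isomorphic (induced struct (H ` points B)) B"
    using isomorphic_sym by (auto simp: isomorphic_def)
qed

end

text \<open>Lexicographic order: first the part, then an injective numbering \<open>f\<close> with
  values below \<open>M\<close>.\<close>

lemma partite_structure_key:
  assumes "finite V"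
  obtains key where "partite_structure V \<pi> key"
proof -
  obtain f :: "'a \<Rightarrow> nat" and M where f: "f ` V = {i. i < M}" "inj_on f V"
    using finite_imp_inj_to_nat_seg[OF assms] by blast
  have less: "\<pi> x * M + f x < \<pi> y * M + f y" if "x \<in> V" "y \<in> V" "\<pi> x < \<pi> y" for x y
  proof -
    have "f x < M"
      using f(1) that(1) by blast
    then have "\<pi> x * M + f x < Suc (\<pi> x) * M"
      by simp
    also have "\<dots> \<le> \<pi> y * M"
      using that(3) by (intro mult_le_mono1) simp
    finally show ?thesis
      by simp
  qed
  have "partite_structure V \<pi> (\<lambda>x. \<pi> x * M + f x)"
  proof
    show "inj_on (\<lambda>x. \<pi> x * M + f x) V"
    proof (rule inj_onI)
      fix x y assume xy: "x \<in> V" "y \<in> V" "\<pi> x * M + f x = \<pi> y * M + f y"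
      then have "\<pi> x = \<pi> y"
        using less[of x y] less[of y x] by (cases "\<pi> x" "\<pi> y" rule: linorder_cases) auto
      then show "x = y"
        using xy f(2) by (simp add: inj_on_eq_iff)
    qed
  qed (rule less)
  then show thesis
    by (rule that)
qed

text \<open>Parts and labels are preserved exactly, so the labelling of \<open>S\<close> can be read
  off its image. This brings a copy found in the final system back to where the colours are
  controlled.\<close>

lemma partite_hom_transversal_reflect:
  assumes h: "partite_hom V \<pi> c V' \<pi>' c' h" and S: "S \<subseteq> V" "inj_on \<pi> S"
    and img: "h ` S \<in> transversals V' \<pi>' c' e t"
  shows "S \<in> transversals V \<pi> c e t"
proof -
  have part: "\<pi>' (h x) = \<pi> x" if "x \<in> S" for x
    using h S(1) that by (auto simp: partite_hom_def)
  have "\<pi> ` S = \<pi>' ` h ` S"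
    using part by (force simp: image_iff)
  then have "bij_betw \<pi> S e"
    using img S(2) by (simp add: transversals_def bij_betw_def)
  moreover have "c x y = t (\<pi> x) (\<pi> y)" if "x \<in> S" "y \<in> S" "\<pi> x < \<pi> y" for x y
  proof -
    have "c' (h x) (h y) = t (\<pi>' (h x)) (\<pi>' (h y))"
      using img that part by (simp add: transversals_def)
    moreover have "c' (h x) (h y) = c x y"
      using h S(1) that by (auto simp: partite_hom_def subset_iff)
    ultimately show ?thesis
      using part that by simp
  qed
  ultimately show ?thesis
    using S(1) by (simp add: transversals_def)
qed

lemma coded_arrow:
  fixes A :: "'b ord_ech_struct" and B :: "'c ord_ech_struct"
  assumes A: "coded A \<kappa>A \<delta>A" and B: "coded B \<kappa>B \<delta>B" "finite (points B)" "points B \<noteq> {}"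
    and k: "k \<ge> 1"
  shows "\<exists>C :: 'a::infinite ord_ech_struct.
    ordered_echeloned_space C \<and> finite (points C) \<and> arrow k C B A"
proof -
  let ?KA = "\<kappa>A ` points A" and ?DA = "labels \<kappa>A \<delta>A (points A)"
  let ?KB = "\<kappa>B ` points B" and ?DB = "labels \<kappa>B \<delta>B (points B)"
  from finite_product_ramsey[of k "card ?KB" "card ?DB" "card ?KA" "card ?DA"] obtain p N :: nat
    where ramsey: "\<forall>f. range f \<subseteq> {..<k} \<longrightarrow>
      (\<exists>E \<psi> d. E \<subseteq> {..<p} \<and> card E = card ?KB \<and> \<psi> \<subseteq> {..<N} \<and> card \<psi> = card ?DB \<and> d < k \<and>
        (\<forall>e \<phi>. e \<subseteq> E \<and> card e = card ?KA \<and> \<phi> \<subseteq> \<psi> \<and> card \<phi> = card ?DA \<longrightarrow> f (e, \<phi>) = d))"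
    by (elim exE) (rule that)
  \<comment> \<open>One disjoint copy of \<open>B\<close> for each admissible pair
    \<open>(E, \<psi>)\<close>, since the good pair is known only after the colouring.\<close>
  define V0 where "V0 = {E. E \<subseteq> {..<p} \<and> card E = card ?KB} \<times>
      {\<psi>. \<psi> \<subseteq> {..<N} \<and> card \<psi> = card ?DB} \<times> points B"
  define \<pi>0 where "\<pi>0 = (\<lambda>(E :: nat set, \<psi> :: nat set, x). relabel ?KB E (\<kappa>B x))"
  \<comment> \<open>Within the copy over \<open>(E, \<psi>)\<close> the labels are the distances of
    \<open>B\<close> moved into \<open>\<psi>\<close>; between different copies they are
    arbitrary.\<close>
  define c0 where "c0 = (\<lambda>(E :: nat set, \<psi>, x) (E' :: nat set, \<psi>' :: nat set, y). relabel ?DB \<psi> (\<delta>B x y))"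
  have "finite V0"
    unfolding V0_def using B(2) by (intro finite_cartesian_product) auto
  then obtain V1 \<pi>1 c1 and g :: "nat set \<times> nat set \<times> 'c \<Rightarrow> 'a" where V1: "finite V1"
    and g: "partite_hom V0 \<pi>0 c0 V1 \<pi>1 c1 g"
    by (rule partite_transfer)
  let ?pat = "pattern A \<kappa>A \<delta>A"
  obtain ets where ets: "set ets = (\<lambda>(e, \<phi>). (e, ?pat e \<phi>)) ` (Pow {..<p} \<times> Pow {..<N})"
    using finite_list[of "(\<lambda>(e, \<phi>). (e, ?pat e \<phi>)) ` (Pow {..<p} \<times> Pow {..<N})"] by auto
  from partite_ramsey[OF V1, of k ets \<pi>1 c1] obtain V2 :: "'a set" and \<pi>2 c2
    where V2: "finite V2" and arr: "partite_arrow k ets V1 \<pi>1 c1 V2 \<pi>2 c2"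
    by (elim exE conjE)
  obtain key where "partite_structure V2 \<pi>2 key"
    using partite_structure_key[OF V2] .
  then interpret partite_structure V2 \<pi>2 c2 key .
  have arrow: "arrow k struct B A"
    unfolding arrow_def points_struct
  proof (intro allI impI)
    fix \<chi> :: "'a set \<Rightarrow> nat"
    assume \<chi>: "range \<chi> \<subseteq> {..<k}"
    from arr[unfolded partite_arrow_def, rule_format, OF \<chi>] obtain h
      where h: "partite_hom V1 \<pi>1 c1 V2 \<pi>2 c2 h"
        and mono: "\<forall>et\<in>set ets. \<exists>d. \<forall>S\<in>transversals V1 \<pi>1 c1 (fst et) (snd et). \<chi> (h ` S) = d"
      by (elim exE conjE)
    \<comment> \<open>The colour \<open>d\<close> of the pair \<open>q\<close> of a set of parts and
      a set of labels. Without transversals constancy does not bound \<open>d\<close>, so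
      \<open>d < k\<close> is demanded and 0 is the default.\<close>
    let ?good = "\<lambda>q d. d < k \<and> (fst q \<subseteq> {..<p} \<and> snd q \<subseteq> {..<N} \<longrightarrow>
      (\<forall>S\<in>transversals V1 \<pi>1 c1 (fst q) (?pat (fst q) (snd q)). \<chi> (h ` S) = d))"
    have "\<forall>q. \<exists>d. ?good q d"
    proof
      fix q :: "nat set \<times> nat set"
      show "\<exists>d. ?good q d"
      proof (cases "fst q \<subseteq> {..<p} \<and> snd q \<subseteq> {..<N} \<and>
          transversals V1 \<pi>1 c1 (fst q) (?pat (fst q) (snd q)) \<noteq> {}")
        case True
        then have "q \<in> Pow {..<p} \<times> Pow {..<N}"
          by (simp add: mem_Times_iff)
        then have "(fst q, ?pat (fst q) (snd q)) \<in> set ets"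
          unfolding ets by (rule rev_image_eqI) (simp add: split_def)
        from mono[rule_format, OF this] obtain d
          where d: "\<forall>S\<in>transversals V1 \<pi>1 c1 (fst q) (?pat (fst q) (snd q)). \<chi> (h ` S) = d"
          unfolding fst_conv snd_conv by (elim exE)
        obtain S where "S \<in> transversals V1 \<pi>1 c1 (fst q) (?pat (fst q) (snd q))"
          using True by auto
        then have "\<chi> (h ` S) = d"
          using d by (simp only:)
        then have "d < k"
          using \<chi> by auto
        with d show ?thesis
          by (intro exI[of _ d] conjI impI)
      next
        case False
        then show ?thesis
          using k by (intro exI[of _ 0]) auto
      qed
    qed
    from choice[OF this] obtain col where col: "\<forall>q. ?good q (col q)"
      by (elim exE)
    then have "range col \<subseteq> {..<k}"
      by auto
    \<comment> \<open>This selects the copy of \<open>B\<close> over \<open>(E, \<psi>)\<close>: for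
      pairs inside it of the sizes belonging to \<open>A\<close>, the colour no longer depends on
      the pair.\<close>
    from ramsey[rule_format, OF this] obtain E \<psi> d
      where E: "E \<subseteq> {..<p}" "card E = card ?KB" and \<psi>: "\<psi> \<subseteq> {..<N}" "card \<psi> = card ?DB"
        and d: "d < k" "\<forall>e \<phi>. e \<subseteq> E \<and> card e = card ?KA \<and> \<phi> \<subseteq> \<psi> \<and> card \<phi> = card ?DA \<longrightarrow>
          col (e, \<phi>) = d"
      by (elim exE conjE) (rule that)
    have fin: "finite E" "finite \<psi>"
      using E(1) \<psi>(1) finite_subset by blast+
    define b where "b x = g (E, \<psi>, x)" for x
    have V0: "(E, \<psi>, x) \<in> V0" if "x \<in> points B" for x
      using E \<psi> that by (simp add: V0_def)
    have b: "b x \<in> V1" "\<pi>1 (b x) = relabel ?KB E (\<kappa>B x)" if "x \<in> points B" for x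
      using g V0[OF that] by (auto simp: b_def partite_hom_def \<pi>0_def)
    have less: "relabel ?KB E (\<kappa>B x) < relabel ?KB E (\<kappa>B y) \<longleftrightarrow> \<kappa>B x < \<kappa>B y"
      if "x \<in> points B" "y \<in> points B" for x y
      by (rule relabel_less) (use that B(2) E fin in auto)
    define H where "H x = h (b x)" for x
    have H: "H x \<in> V2" "\<pi>2 (H x) = relabel ?KB E (\<kappa>B x)" if "x \<in> points B" for x
      using h b[OF that] by (auto simp: H_def partite_hom_def)
    have H_label: "c2 (H x) (H y) = relabel ?DB \<psi> (\<delta>B x y)"
      if xy: "x \<in> points B" "y \<in> points B" "\<kappa>B x < \<kappa>B y" for x y
    proof -
      have "\<pi>0 (E, \<psi>, x) < \<pi>0 (E, \<psi>, y)"
        using less[OF xy(1,2)] xy(3) by (simp add: \<pi>0_def)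
      moreover have "partite_hom V0 \<pi>0 c0 V2 \<pi>2 c2 (h \<circ> g)"
        by (rule partite_hom_comp[OF g h])
      ultimately have "c2 ((h \<circ> g) (E, \<psi>, x)) ((h \<circ> g) (E, \<psi>, y)) = c0 (E, \<psi>, x) (E, \<psi>, y)"
        using V0[OF xy(1)] V0[OF xy(2)] unfolding partite_hom_def by blast
      then show ?thesis
        by (simp add: H_def b_def c0_def)
    qed
    have HV: "H ` points B \<subseteq> V2"
      using H(1) by blast
    note copy = isomorphic_relabelled[OF B(1,2) fin(1) E(2)[symmetric] fin(2) \<psi>(2)[symmetric] HV H(2) H_label]
    have "\<chi> S = d" if S: "S \<subseteq> H ` points B" "S \<noteq> {}" "isomorphic (induced struct S) A" for S
    proof -
      obtain Q where Q: "Q \<subseteq> points B" "S = H ` Q"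
        using S(1) by (auto simp: subset_image_iff)
      let ?e = "\<pi>2 ` S" and ?\<phi> = "labels \<pi>2 c2 S"
      have S': "finite S" "S \<subseteq> V2" "inj_on \<pi>2 S"
        using S(1) B(2) HV copy(1) by (auto intro: finite_subset inj_on_subset)
      note tr = isomorphic_imp_transversal[OF A S' S(3)]
      have "?e \<subseteq> E"
      proof -
        have "\<pi>2 (H x) \<in> E" if "x \<in> points B" for x
          unfolding H(2)[OF that] by (rule relabel_in) (use that B(2) E fin in auto)
        then show ?thesis
          using Q by auto
      qed
      moreover have "?\<phi> \<subseteq> \<psi>"
      proof
        fix l assume "l \<in> ?\<phi>"
        then obtain u v where uv: "u \<in> S" "v \<in> S" "\<pi>2 u < \<pi>2 v" and l: "l = c2 u v"
          by (auto simp: labels_def increasing_pairs_def)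
        obtain x y where "x \<in> points B" "u = H x" "y \<in> points B" "v = H y"
          using uv(1,2) S(1) by blast
        then have xy: "x \<in> points B" "y \<in> points B" "\<pi>2 (H x) < \<pi>2 (H y)"
          and l: "l = c2 (H x) (H y)"
          using uv(3) l by simp_all
        have "\<kappa>B x < \<kappa>B y"
          using xy(3) less[OF xy(1,2)] H(2) xy(1,2) by simp
        then have "l = relabel ?DB \<psi> (\<delta>B x y)" "\<delta>B x y \<in> ?DB"
          using H_label xy l by (auto simp: labelsI)
        then show "l \<in> \<psi>"
          using relabel_in[OF finite_labels[OF B(2)] fin(2) \<psi>(2)[symmetric]] by simp
      qed
      ultimately have col_d: "col (?e, ?\<phi>) = d" and sub: "?e \<subseteq> {..<p}" "?\<phi> \<subseteq> {..<N}"
        using d(2) tr(1,2) E(1) \<psi>(1) by auto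
      \<comment> \<open>\<open>col\<close> speaks about images under \<open>h\<close> of
        transversals of \<open>V1\<close>, so \<open>S\<close> is written as the image of such a
        set, namely the image of \<open>Q\<close> under \<open>b\<close>.\<close>
      have "S = h ` b ` Q"
        by (simp add: Q(2) H_def image_image)
      moreover have "b ` Q \<in> transversals V1 \<pi>1 c1 ?e (?pat ?e ?\<phi>)"
      proof (rule partite_hom_transversal_reflect[OF h])
        show "b ` Q \<subseteq> V1"
          using b(1) Q(1) by blast
        show "inj_on \<pi>1 (b ` Q)"
        proof (rule inj_onI)
          fix u v assume "u \<in> b ` Q" "v \<in> b ` Q" and eq: "\<pi>1 u = \<pi>1 v"
          then obtain x y where xy: "x \<in> Q" "y \<in> Q" "u = b x" "v = b y"
            by blast
          then have "x \<in> points B" "y \<in> points B"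
            using Q(1) by auto
          with eq xy have "\<kappa>B x = \<kappa>B y"
            using b(2) less[of x y] less[of y x] by (metis linorder_neqE_nat less_irrefl)
          then have "x = y"
            using B(1) \<open>x \<in> points B\<close> \<open>y \<in> points B\<close> by (auto simp: coded_def inj_on_def)
          then show "u = v"
            using xy by simp
        qed
        show "h ` b ` Q \<in> transversals V2 \<pi>2 c2 ?e (?pat ?e ?\<phi>)"
          using tr(3) by (simp only: \<open>S = h ` b ` Q\<close>)
      qed
      ultimately show ?thesis
        using col[rule_format, of "(?e, ?\<phi>)"] col_d sub by simp
    qed
    then show "\<exists>T i. T \<subseteq> V2 \<and> T \<noteq> {} \<and> isomorphic (induced struct T) B \<and> i < k \<and>
        (\<forall>S. S \<subseteq> T \<and> S \<noteq> {} \<and> isomorphic (induced struct S) A \<longrightarrow> \<chi> S = i)"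
      using HV B(3) copy(2) d(1) by (intro exI[of _ "H ` points B"] exI[of _ d]) simp
  qed
  \<comment> \<open>Any colouring shows that \<open>V2\<close> is non-empty, as the set
    \<open>T\<close> it yields is non-empty and lies in \<open>V2\<close>.\<close>
  have "range (\<lambda>S :: 'a set. 0 :: nat) \<subseteq> {..<k}"
    using k by auto
  from arrow[unfolded arrow_def, rule_format, OF this] have "V2 \<noteq> {}"
    unfolding points_struct by auto
  then show ?thesis
    using V2 arrow ordered_echeloned_space_struct points_struct by (intro exI[of _ struct]) simp
qed

section \<open>The Ramsey property of the class and of its limit\<close>

lemma finite_ordered_echeloned_spaces_arrow:
  assumes "A \<in> finite_ordered_echeloned_spaces" "B \<in> finite_ordered_echeloned_spaces" "k \<ge> 1"
  shows "\<exists>C\<in>finite_ordered_echeloned_spaces :: 'a::infinite ord_ech_struct set. arrow k C B A"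
proof -
  have AB: "ordered_echeloned_space A" "finite (points A)" "ordered_echeloned_space B" "finite (points B)"
    using assms by (auto simp: finite_ordered_echeloned_spaces_def)
  obtain \<kappa>A \<delta>A \<kappa>B \<delta>B where "coded A \<kappa>A \<delta>A" "coded B \<kappa>B \<delta>B"
    using AB ordered_echeloned_space_coded by metis
  moreover have "points B \<noteq> {}"
    using AB(3) by (simp add: ordered_echeloned_space_def echeloned_space_def)
  ultimately have "\<exists>C :: 'a ord_ech_struct.
      ordered_echeloned_space C \<and> finite (points C) \<and> arrow k C B A"
    using AB(4) assms(3) by (intro coded_arrow)
  then show ?thesis
    by (auto simp: finite_ordered_echeloned_spaces_def)
qed

theorem theorem4p6:
  shows "(\<forall>F :: 'f ord_ech_struct.
            fraisse_limit (finite_ordered_echeloned_spaces :: 'a::infinite ord_ech_struct set) F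
              \<longrightarrow> ramsey_property F) \<and>
         ramsey_class (finite_ordered_echeloned_spaces :: 'a::infinite ord_ech_struct set)"
proof (intro conjI allI impI)
  let ?K = "finite_ordered_echeloned_spaces :: 'a ord_ech_struct set"
  show "ramsey_class ?K"
    by (rule ramsey_class_if_arrow) (rule finite_ordered_echeloned_spaces_arrow)
  fix F :: "'f ord_ech_struct"
  assume "fraisse_limit ?K F"
  then have into: "\<And>A. A \<in> age F \<Longrightarrow> \<exists>B\<in>?K. isomorphic A B"
    and onto: "\<And>B. B \<in> ?K \<Longrightarrow> \<exists>A\<in>age F. isomorphic A B"
    by (auto simp: fraisse_limit_def)
  show "ramsey_property F"
    unfolding ramsey_property_def
  proof (rule ramsey_class_if_arrow)
    fix A B :: "'f ord_ech_struct" and k :: nat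
    assume "A \<in> age F" "B \<in> age F" "k \<ge> 1"
    \<comment> \<open>\<open>F\<close> may live on another type than the class, so \<open>A\<close>
      and \<open>B\<close> are replaced by isomorphic members of the class, and the arrow found
      there is carried back into the age.\<close>
    then obtain A0 B0 where A0: "A0 \<in> ?K" "isomorphic A A0" and B0: "B0 \<in> ?K" "isomorphic B B0"
      using into by meson
    obtain C0 where C0: "C0 \<in> ?K" "arrow k C0 B0 A0"
      using finite_ordered_echeloned_spaces_arrow[OF A0(1) B0(1) \<open>k \<ge> 1\<close>] by blast
    obtain C where C: "C \<in> age F" "isomorphic C C0"
      using onto[OF C0(1)] by blast
    have "arrow k C B A"
      using C0(2) by (rule arrow_isomorphic) (use A0 B0 C isomorphic_sym in auto)
    with C(1) show "\<exists>C\<in>age F. arrow k C B A"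
      by blast
  qed
qed

end
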